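(* Let $u$ be a homogeneous element of weakly nilpotent type of the Weyl algebra $A_1$, i.e. $u\in\Delta_2$. Then: 1. The associated graded algebra $\mathcal{G}(u,A_1)$ is an affine commutative algebra, hence the algebra $N(u,A_1)$ is an affine Noetherian algebra. 2. The algebra $A_1$ is not a finitely generated (left and right) $N(u,A_1)$-module, i.e. it is finitely generated neither as a left nor as a right $N(u,A_1)$-module.
   Context: $K$ is a field of characteristic zero. $A_1$ is the first Weyl algebra over $K$, generated by $X,Y$ with $YX-XY=1$, and $H=YX$. Put $v_n=X^n$ for $n>0$, $v_n=Y^{-n}$ for $n<0$, $v_0=1$; then $A_1=\bigoplus_{i\in\mathbb{Z}}K[H]v_i$ is $\mathbb{Z}$-graded, and "homogeneous" refers to this grading. "Affine" means finitely generated as a $K$-algebra. For non-scalar $u\in A_1$: $\mathrm{ad}\,u(a)=ua-au$; $N(u,i,A_1)=\ker(\mathrm{ad}\,u)^{i+1}$ for $i\geq 0$, $N(u,-1,A_1)=0$; $N(u,A_1)=\bigcup_{i\geq 0}N(u,i,A_1)$, an $\mathbb{N}$-filtered algebra; $C(u,A_1)=N(u,0,A_1)$ is the centralizer of $u$; $\mathcal{G}(u,A_1)=\bigoplus_{i\geq 0}N(u,i,A_1)/N(u,i-1,A_1)$. A non-scalar element $u\in A_1$ is of weakly nilpotent type (equivalently, belongs to Dixmier's class $\Delta_2$) if $C(u,A_1)\neq N(u,A_1)\neq A_1$. *)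

theory Defs
  imports
    "HOL-Algebra.Algebra"
    "HOL-Algebra.Algebraic_Closure_Type"
    "HOL-Computational_Algebra.Polynomial"
    "HOL-Library.Set_Algebras"
begin

section \<open>The first Weyl algebra\<close>

text \<open>
  The Weyl algebra is defined by its presentation: formal expressions in two generators with
  coefficients in a field, modulo the least congruence that contains the axioms of
  associative unital algebras over the field and the relation \<open>Y X = X Y + 1\<close>.
\<close>

datatype 'k wexp =
    WConst 'k
  | WX
  | WY
  | WAdd "'k wexp" "'k wexp"
  | WMul "'k wexp" "'k wexp"

inductive weq :: "'k::field wexp \<Rightarrow> 'k wexp \<Rightarrow> bool" where
  weq_refl: "weq a a"
| weq_sym: "weq a b \<Longrightarrow> weq b a"
| weq_trans: "weq a b \<Longrightarrow> weq b c \<Longrightarrow> weq a c"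
| weq_add: "weq a a' \<Longrightarrow> weq b b' \<Longrightarrow> weq (WAdd a b) (WAdd a' b')"
| weq_mul: "weq a a' \<Longrightarrow> weq b b' \<Longrightarrow> weq (WMul a b) (WMul a' b')"
| weq_add_assoc: "weq (WAdd (WAdd a b) c) (WAdd a (WAdd b c))"
| weq_add_comm: "weq (WAdd a b) (WAdd b a)"
| weq_add_zero: "weq (WAdd (WConst 0) a) a"
| weq_add_neg: "weq (WAdd (WMul (WConst (-1)) a) a) (WConst 0)"
| weq_mul_assoc: "weq (WMul (WMul a b) c) (WMul a (WMul b c))"
| weq_one_mul: "weq (WMul (WConst 1) a) a"
| weq_mul_one: "weq (WMul a (WConst 1)) a"
| weq_distrib_right: "weq (WMul (WAdd a b) c) (WAdd (WMul a c) (WMul b c))"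
| weq_distrib_left: "weq (WMul a (WAdd b c)) (WAdd (WMul a b) (WMul a c))"
| weq_const_add: "weq (WConst (r + s)) (WAdd (WConst r) (WConst s))"
| weq_const_mul: "weq (WConst (r * s)) (WMul (WConst r) (WConst s))"
| weq_const_central: "weq (WMul (WConst r) a) (WMul a (WConst r))"
| weq_relation: "weq (WMul WY WX) (WAdd (WMul WX WY) (WConst 1))"

text \<open>
  The action on polynomials, with \<open>X\<close> acting by multiplication and \<open>Y\<close> by differentiation, is only
  used to see that \<open>0 \<noteq> 1\<close> in the quotient.
\<close>

fun wact :: "'k::field wexp \<Rightarrow> 'k poly \<Rightarrow> 'k poly" where
  "wact (WConst c) p = smult c p"
| "wact WX p = [:0, 1:] * p"
| "wact WY p = pderiv p"
| "wact (WAdd a b) p = wact a p + wact b p"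
| "wact (WMul a b) p = wact a (wact b p)"

lemma wact_add: "wact a (p + q) = wact a p + wact a q"
  by (induction a arbitrary: p q) (simp_all add: smult_add_right pderiv_add algebra_simps)

lemma wact_smult: "wact a (smult r p) = smult r (wact a p)"
  by (induction a arbitrary: p) (simp_all add: smult_add_right pderiv_smult mult.commute)

lemma weq_wact: "weq a b \<Longrightarrow> wact a p = wact b p"
proof (induction arbitrary: p rule: weq.induct)
  case weq_relation
  then show ?case
    by (simp add: pderiv_pCons)
qed (simp_all add: wact_add wact_smult smult_add_left algebra_simps)

quotient_type (overloaded) 'k weyl = "'k::field wexp" / weq
proof (rule equivpI)
  show "reflp (weq :: 'k wexp \<Rightarrow> _)" by (auto intro: reflpI weq_refl)
  show "symp (weq :: 'k wexp \<Rightarrow> _)" by (auto intro: sympI weq_sym)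
  show "transp (weq :: 'k wexp \<Rightarrow> _)" by (auto intro: transpI weq_trans)
qed

instantiation weyl :: (field) ring_1
begin

lift_definition zero_weyl :: "'a weyl" is "WConst 0" .
lift_definition one_weyl :: "'a weyl" is "WConst 1" .
lift_definition plus_weyl :: "'a weyl \<Rightarrow> 'a weyl \<Rightarrow> 'a weyl" is WAdd by (rule weq_add)
lift_definition times_weyl :: "'a weyl \<Rightarrow> 'a weyl \<Rightarrow> 'a weyl" is WMul by (rule weq_mul)
lift_definition uminus_weyl :: "'a weyl \<Rightarrow> 'a weyl" is "WMul (WConst (-1))"
  by (intro weq_mul weq_refl)
lift_definition minus_weyl :: "'a weyl \<Rightarrow> 'a weyl \<Rightarrow> 'a weyl"
  is "\<lambda>a b. WAdd a (WMul (WConst (-1)) b)"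
  by (intro weq_add weq_mul weq_refl)

instance
proof
  fix a b c :: "'a weyl"
  show "a + b + c = a + (b + c)" by transfer (rule weq_add_assoc)
  show "a + b = b + a" by transfer (rule weq_add_comm)
  show "0 + a = a" by transfer (rule weq_add_zero)
  show "- a + a = 0" by transfer (rule weq_add_neg)
  show "a - b = a + - b" by transfer (rule weq_refl)
  show "a * b * c = a * (b * c)" by transfer (rule weq_mul_assoc)
  show "1 * a = a" by transfer (rule weq_one_mul)
  show "a * 1 = a" by transfer (rule weq_mul_one)
  show "(a + b) * c = a * c + b * c" by transfer (rule weq_distrib_right)
  show "a * (b + c) = a * b + a * c" by transfer (rule weq_distrib_left)
  show "(0 :: 'a weyl) \<noteq> 1"
  proof transfer
    show "\<not> weq (WConst (0::'a)) (WConst 1)"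
      using weq_wact[of "WConst (0::'a)" "WConst 1" 1] by auto
  qed
qed

end

lift_definition weyl_const :: "'k::field \<Rightarrow> 'k weyl" is WConst .
lift_definition weyl_X :: "'k::field weyl" is WX .
lift_definition weyl_Y :: "'k::field weyl" is WY .

lemma weyl_commutator: "weyl_Y * weyl_X - weyl_X * weyl_Y = (1 :: 'k::field weyl)"
proof -
  have "weyl_Y * weyl_X = weyl_X * weyl_Y + (1 :: 'k weyl)"
    by transfer (rule weq_relation)
  then show ?thesis by simp
qed

definition weyl_H :: "'k::field weyl" where
  "weyl_H = weyl_Y * weyl_X"

definition weyl_v :: "int \<Rightarrow> 'k::field weyl" where
  "weyl_v n = (if n \<ge> 0 then weyl_X ^ nat n else weyl_Y ^ nat (- n))"


section \<open>Associative algebras\<close>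

text \<open>The library locale \<open>algebra\<close> covers commutative algebras only.\<close>

locale assoc_algebra = module R M + ring M for R (structure) and M (structure) +
  assumes smult_mult_left:
      "\<lbrakk>a \<in> carrier R; x \<in> carrier M; y \<in> carrier M\<rbrakk> \<Longrightarrow>
        (a \<odot>\<^bsub>M\<^esub> x) \<otimes>\<^bsub>M\<^esub> y = a \<odot>\<^bsub>M\<^esub> (x \<otimes>\<^bsub>M\<^esub> y)"
    and smult_mult_right:
      "\<lbrakk>a \<in> carrier R; x \<in> carrier M; y \<in> carrier M\<rbrakk> \<Longrightarrow>
        x \<otimes>\<^bsub>M\<^esub> (a \<odot>\<^bsub>M\<^esub> y) = a \<odot>\<^bsub>M\<^esub> (x \<otimes>\<^bsub>M\<^esub> y)"

text \<open>The unital subalgebra generated by a set.\<close>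

inductive_set algebra_generate ::
    "('a, 'c) ring_scheme \<Rightarrow> ('a, 'b, 'd) module_scheme \<Rightarrow> 'b set \<Rightarrow> 'b set"
  for R and M and S where
  one: "\<one>\<^bsub>M\<^esub> \<in> algebra_generate R M S"
| incl: "x \<in> S \<Longrightarrow> x \<in> algebra_generate R M S"
| add: "x \<in> algebra_generate R M S \<Longrightarrow> y \<in> algebra_generate R M S \<Longrightarrow>
    x \<oplus>\<^bsub>M\<^esub> y \<in> algebra_generate R M S"
| mult: "x \<in> algebra_generate R M S \<Longrightarrow> y \<in> algebra_generate R M S \<Longrightarrow>
    x \<otimes>\<^bsub>M\<^esub> y \<in> algebra_generate R M S"
| smult: "a \<in> carrier R \<Longrightarrow> x \<in> algebra_generate R M S \<Longrightarrow>
    a \<odot>\<^bsub>M\<^esub> x \<in> algebra_generate R M S"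

definition affine_algebra :: "('a, 'c) ring_scheme \<Rightarrow> ('a, 'b, 'd) module_scheme \<Rightarrow> bool" where
  "affine_algebra R M \<longleftrightarrow> assoc_algebra R M \<and>
    (\<exists>S. finite S \<and> S \<subseteq> carrier M \<and> algebra_generate R M S = carrier M)"

definition left_ideal :: "'b set \<Rightarrow> ('b, 'd) ring_scheme \<Rightarrow> bool" where
  "left_ideal I M \<longleftrightarrow> additive_subgroup I M \<and> (\<forall>r\<in>carrier M. \<forall>x\<in>I. r \<otimes>\<^bsub>M\<^esub> x \<in> I)"

definition right_ideal :: "'b set \<Rightarrow> ('b, 'd) ring_scheme \<Rightarrow> bool" where
  "right_ideal I M \<longleftrightarrow> additive_subgroup I M \<and> (\<forall>r\<in>carrier M. \<forall>x\<in>I. x \<otimes>\<^bsub>M\<^esub> r \<in> I)"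

text \<open>
  The library locale \<open>noetherian_ring\<close> speaks about two-sided ideals; for noncommutative rings
  Noetherian means that all left ideals and all right ideals are finitely generated.
\<close>

definition noetherian :: "('b, 'd) ring_scheme \<Rightarrow> bool" where
  "noetherian M \<longleftrightarrow> ring M \<and>
    (\<forall>I. left_ideal I M \<longrightarrow> (\<exists>S. finite S \<and> S \<subseteq> I \<and> I = \<Inter>{J. left_ideal J M \<and> S \<subseteq> J})) \<and>
    (\<forall>I. right_ideal I M \<longrightarrow> (\<exists>S. finite S \<and> S \<subseteq> I \<and> I = \<Inter>{J. right_ideal J M \<and> S \<subseteq> J}))"

text \<open>Finite generation of a whole ring as a left or right module over a subring \<open>B\<close>.\<close>

definition fg_left_over :: "'a::ring_1 set \<Rightarrow> bool" where
  "fg_left_over B \<longleftrightarrow>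
    (\<exists>S. finite S \<and> (\<forall>a. \<exists>c. (\<forall>s\<in>S. c s \<in> B) \<and> a = (\<Sum>s\<in>S. c s * s)))"

definition fg_right_over :: "'a::ring_1 set \<Rightarrow> bool" where
  "fg_right_over B \<longleftrightarrow>
    (\<exists>S. finite S \<and> (\<forall>a. \<exists>c. (\<forall>s\<in>S. c s \<in> B) \<and> a = (\<Sum>s\<in>S. s * c s)))"


section \<open>The Weyl algebra as an algebra, and its grading\<close>

abbreviation base_field :: "'k::field ring" where
  "base_field \<equiv> ring_of_type_algebra"

definition weyl_algebra :: "('k::field, 'k weyl) module" where
  "weyl_algebra = \<lparr>carrier = UNIV, monoid.mult = (*), one = 1, ring.zero = 0, add = (+),
    module.smult = (\<lambda>c a. weyl_const c * a)\<rparr>"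

definition weyl_component :: "int \<Rightarrow> 'k::field weyl set" where
  "weyl_component i = {a * weyl_v i |a. a \<in> algebra_generate base_field weyl_algebra {weyl_H}}"

definition weyl_homogeneous :: "'k::field weyl \<Rightarrow> bool" where
  "weyl_homogeneous u \<longleftrightarrow> (\<exists>i. u \<in> weyl_component i)"


section \<open>The filtration defined by an inner derivation\<close>

definition ad :: "'a::ring \<Rightarrow> 'a \<Rightarrow> 'a" where
  "ad u a = u * a - a * u"

text \<open>For \<open>i = -1\<close> the filtration step is the zero subspace.\<close>

definition nil_filt :: "'a::ring \<Rightarrow> int \<Rightarrow> 'a set" where
  "nil_filt u i = (if i < 0 then {0} else {a. (ad u ^^ (nat i + 1)) a = 0})"

definition nil_set :: "'a::ring \<Rightarrow> 'a set" where
  "nil_set u = (\<Union>i\<in>{0..}. nil_filt u i)"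

definition weyl_centralizer :: "'k::field weyl \<Rightarrow> 'k weyl set" where
  "weyl_centralizer u = nil_filt u 0"

definition weakly_nilpotent_type :: "'k::field weyl \<Rightarrow> bool" where
  "weakly_nilpotent_type u \<longleftrightarrow>
    u \<notin> range weyl_const \<and> weyl_centralizer u \<noteq> nil_set u \<and> nil_set u \<noteq> UNIV"

definition nil_algebra :: "'k::field weyl \<Rightarrow> ('k, 'k weyl) module" where
  "nil_algebra u = weyl_algebra\<lparr>carrier := nil_set u\<rparr>"

text \<open>
  An element of the associated graded algebra is a finitely supported family \<open>g\<close> whose \<open>i\<close>-th
  component is a coset of step \<open>i - 1\<close> of the filtration in step \<open>i\<close>. Sums and products of cosets
  are taken elementwise (as sets); adding the subspace that is factored out turns the set
  product of two cosets into the coset of the product of representatives.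
\<close>

definition graded_algebra :: "'k::field weyl \<Rightarrow> ('k, nat \<Rightarrow> 'k weyl set) module" where
  "graded_algebra u =
    \<lparr>carrier = {g. (\<forall>i. \<exists>a \<in> nil_filt u (int i). g i = {a} + nil_filt u (int i - 1)) \<and>
                   finite {i. g i \<noteq> nil_filt u (int i - 1)}},
     monoid.mult = (\<lambda>g h n. \<Sum>i\<le>n. g i * h (n - i) + nil_filt u (int n - 1)),
     one = (\<lambda>i. {if i = 0 then 1 else 0} + nil_filt u (int i - 1)),
     ring.zero = (\<lambda>i. nil_filt u (int i - 1)),
     add = (\<lambda>g h i. g i + h i),
     module.smult = (\<lambda>c g i. {weyl_const c} * g i + nil_filt u (int i - 1))\<rparr>"

end

theory Submission
  imports Defs "HOL-Computational_Algebra.Formal_Power_Series"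
begin

text \<open>
  Letting \<open>A\<^sub>1\<close> act by difference operators on functions on \<open>K\<close>, a homogeneous element of degree \<open>m\<close>
  becomes a polynomial \<open>p\<close> followed by a shift by \<open>m\<close>, and up to the automorphism \<open>X \<mapsto> - Y\<close>, \<open>Y \<mapsto> X\<close>
  one may assume \<open>u = \<alpha>(H) X\<^sup>n\<close> with \<open>n > 0\<close> and \<open>\<alpha>\<close> nonconstant. Comparing subleading coefficients
  shows that a homogeneous element of degree \<open>m\<close> and nilpotency degree \<open>i\<close> satisfies
  \<open>n deg p = m deg \<alpha> + n i\<close>. Hence the homogeneous parts of the centralizer are at most
  one-dimensional, the centralizer is commutative, and the pair consisting of the nilpotency degree
  \<open>i\<close> of \<open>a\<close> and the degree of \<open>(ad u)\<^sup>i a\<close> is a valuation on \<open>N(u)\<close> with one-dimensional leaves.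
  Its values lie in the cone spanned by the values of \<open>u\<close> and \<open>Y\<^sup>n\<close>, both of which belong to \<open>N(u)\<close>, so by
  Dickson's lemma the values of every one-sided ideal form a finitely generated module over the
  free monoid on these two vectors. Elements realizing the generators give finite standard bases,
  and all finiteness assertions follow. The standard monomials also show that \<open>N(u)\<close> is
  \<open>u N(u)\<close> up to elements of bounded degree, so that a finite generating set of the module \<open>A\<^sub>1\<close>
  would make a power of \<open>X\<close> divisible by \<open>u\<close>.
\<close>

section \<open>Iterated commutators\<close>

lemma ad_zero [simp]: "ad u 0 = 0"
  by (simp add: ad_def)

lemma ad_add: "ad u (a + b) = ad u a + ad u b"
  by (simp add: ad_def algebra_simps)

lemma ad_diff: "ad u (a - b) = ad u a - ad u b"
  by (simp add: ad_def algebra_simps)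

lemma ad_mult: "ad u (a * b) = ad u a * b + a * ad u b"
  by (simp add: ad_def algebra_simps)

lemma adpow_zero [simp]: "(ad u ^^ n) 0 = 0"
  by (induction n) simp_all

lemma adpow_add: "(ad u ^^ n) (a + b) = (ad u ^^ n) a + (ad u ^^ n) b"
  by (induction n) (simp_all add: ad_add)

lemma adpow_diff: "(ad u ^^ n) (a - b) = (ad u ^^ n) a - (ad u ^^ n) b"
  by (induction n) (simp_all add: ad_diff)

lemma adpow_mult_commuting:
  assumes "ad u c = 0"
  shows "(ad u ^^ n) (c * a) = c * (ad u ^^ n) a"
  by (induction n) (simp_all add: ad_mult assms)

lemma adpow_eq_zero_mono:
  assumes "(ad u ^^ m) a = 0" "m \<le> n"
  shows "(ad u ^^ n) a = 0"
  using assms funpow_add[of "n - m" m "ad u"] by simp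

lemma ad_of_nat [simp]: "ad u (of_nat n) = (0 :: 'a::ring_1)"
  by (induction n) (simp_all add: ad_add, simp_all add: ad_def)

text \<open>In the binomial expansion given by the Leibniz rule, every other term applies
  \<open>ad u\<close> more than \<open>i\<close> times to \<open>a\<close> or more than
  \<open>j\<close> times to \<open>b\<close>.\<close>

lemma adpow_mult_top:
  fixes a b u :: "'a::ring_1"
  assumes "(ad u ^^ Suc i) a = 0" "(ad u ^^ Suc j) b = 0"
  shows "(ad u ^^ (i + j)) (a * b) = of_nat ((i + j) choose i) * ((ad u ^^ i) a * (ad u ^^ j) b)"
  using assms
proof (induction "i + j" arbitrary: i j a b)
  case 0
  then show ?case by simp
next
  case (Suc s)
  have split: "(ad u ^^ (i + j)) (a * b) = (ad u ^^ s) (ad u a * b) + (ad u ^^ s) (a * ad u b)"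
    by (simp add: Suc(2)[symmetric] funpow_swap1 ad_mult adpow_add)
  show ?case
  proof (cases "i = 0 \<or> j = 0")
    case True
    then show ?thesis
    proof
      assume i: "i = 0"
      then obtain j' where j': "j = Suc j'" using Suc(2) by (cases j) auto
      have "(ad u ^^ s) (a * ad u b) = of_nat (s choose 0) * (a * (ad u ^^ s) (ad u b))"
        using Suc(1)[of 0 j' a "ad u b"] Suc i j' by (simp add: funpow_swap1)
      then show ?thesis using split i j' Suc by (simp add: funpow_swap1)
    next
      assume j: "j = 0"
      then obtain i' where i': "i = Suc i'" using Suc(2) by (cases i) auto
      have "(ad u ^^ s) (ad u a * b) = of_nat (s choose s) * ((ad u ^^ s) (ad u a) * b)"
        using Suc(1)[of i' 0 "ad u a" b] Suc j i' by (simp add: funpow_swap1)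
      then show ?thesis using split j i' Suc by (simp add: funpow_swap1)
    qed
  next
    case False
    then obtain i' j' where ij: "i = Suc i'" "j = Suc j'" by (metis not0_implies_Suc)
    have s: "s = i' + j" "s = i + j'" using ij Suc(2) by auto
    have 1: "(ad u ^^ s) (ad u a * b) = of_nat (s choose i') * ((ad u ^^ i) a * (ad u ^^ j) b)"
      using Suc(1)[of i' j "ad u a" b] Suc(3,4) ij s by (simp add: funpow_swap1)
    have 2: "(ad u ^^ s) (a * ad u b) = of_nat (s choose i) * ((ad u ^^ i) a * (ad u ^^ j) b)"
      using Suc(1)[of i j' a "ad u b"] Suc(3,4) ij s by (simp add: funpow_swap1)
    \<comment> \<open>Pascal's rule joins the two halves of the derivative.\<close>
    have "(i + j) choose i = (s choose i') + (s choose i)"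
      using ij Suc(2) by (metis binomial_Suc_Suc)
    then show ?thesis unfolding split 1 2 by (simp add: distrib_right)
  qed
qed

lemma adpow_mult_eq_zero:
  fixes a b u :: "'a::ring_1"
  assumes "(ad u ^^ Suc i) a = 0" "(ad u ^^ Suc j) b = 0"
  shows "(ad u ^^ Suc (i + j)) (a * b) = 0"
  using adpow_mult_top[OF assms] assms by (simp add: ad_mult)

section \<open>Filtration by the kernels of the powers of an inner derivation\<close>

definition adker :: "'a::ring \<Rightarrow> nat \<Rightarrow> 'a set" where
  "adker u n = {a. (ad u ^^ n) a = 0}"

text \<open>The index of \<open>adker\<close> counts applications of \<open>ad u\<close>, so the
  zero step of the filtration becomes \<open>adker u 0\<close> and natural numbers suffice as
  indices.\<close>

lemma nil_filt_eq_adker: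
  "nil_filt u (int n - 1) = adker u n" "nil_filt u (int n) = adker u (Suc n)"
proof -
  show "nil_filt u (int n - 1) = adker u n"
    by (cases n) (auto simp: nil_filt_def adker_def)
  show "nil_filt u (int n) = adker u (Suc n)"
    by (simp add: nil_filt_def adker_def)
qed

lemma nil_set_eq_adker: "nil_set u = (\<Union>n. adker u (Suc n))"
proof -
  have "{0..} = range int" using zero_le_imp_eq_int by auto
  then show ?thesis by (simp add: nil_set_def nil_filt_eq_adker)
qed

lemma adker_0 [simp]: "adker u 0 = {0}"
  by (auto simp: adker_def)

lemma zero_in_adker [simp]: "0 \<in> adker u n"
  by (simp add: adker_def)

lemma adker_add: "a \<in> adker u n \<Longrightarrow> b \<in> adker u n \<Longrightarrow> a + b \<in> adker u n"
  by (simp add: adker_def adpow_add)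

lemma adker_diff: "a \<in> adker u n \<Longrightarrow> b \<in> adker u n \<Longrightarrow> a - b \<in> adker u n"
  by (simp add: adker_def adpow_diff)

lemma adker_minus: "a \<in> adker u n \<Longrightarrow> - a \<in> adker u n"
  using adker_diff[of 0 u n a] by simp

lemma adker_minus_iff: "a - b \<in> adker u n \<longleftrightarrow> b - a \<in> adker u n"
  using adker_minus[of "a - b" u n] adker_minus[of "b - a" u n] by auto

lemma adker_sum: "(\<And>i. i \<in> S \<Longrightarrow> f i \<in> adker u n) \<Longrightarrow> sum f S \<in> adker u n"
  by (induction S rule: infinite_finite_induct) (simp_all add: adker_add)

lemma adker_mono: "m \<le> n \<Longrightarrow> adker u m \<subseteq> adker u n"
  by (auto simp: adker_def intro: adpow_eq_zero_mono)

lemma adker_mult: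
  fixes u :: "'a::ring_1"
  shows "a \<in> adker u (Suc i) \<Longrightarrow> b \<in> adker u (Suc j) \<Longrightarrow> a * b \<in> adker u (Suc (i + j))"
  unfolding adker_def using adpow_mult_eq_zero by blast

text \<open>Only the index of \<open>b\<close> carries a successor, so the zero step is allowed for
  \<open>a\<close>. In this form the lemma makes products of cosets well defined.\<close>

lemma adker_mult_left:
  fixes u :: "'a::ring_1"
  assumes "a \<in> adker u i" "b \<in> adker u (Suc j)"
  shows "a * b \<in> adker u (i + j)"
  using assms adker_mult[of a u _ b j] by (cases i) auto

lemma adker_mult_right:
  fixes u :: "'a::ring_1"
  assumes "a \<in> adker u (Suc i)" "b \<in> adker u j"
  shows "a * b \<in> adker u (i + j)"
  using assms adker_mult[of a u i b] by (cases j) auto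

lemma one_in_adker: "(1 :: 'a::ring_1) \<in> adker u (Suc n)"
  by (simp add: adker_def funpow_swap1 ad_def)

text \<open>The symbols of two elements commute because their top iterated commutators lie in the
  centralizer of \<open>u\<close>.\<close>

lemma adker_commutator:
  fixes u :: "'a::ring_1"
  assumes comm: "\<And>a b. ad u a = 0 \<Longrightarrow> ad u b = 0 \<Longrightarrow> a * b = b * a"
    and "a \<in> adker u (Suc i)" "b \<in> adker u (Suc j)"
  shows "a * b - b * a \<in> adker u (i + j)"
proof -
  have ab: "(ad u ^^ Suc i) a = 0" "(ad u ^^ Suc j) b = 0" using assms by (auto simp: adker_def)
  have "(ad u ^^ i) a * (ad u ^^ j) b = (ad u ^^ j) b * (ad u ^^ i) a"
    using ab by (intro comm) auto
  then have "(ad u ^^ (i + j)) (a * b) = (ad u ^^ (j + i)) (b * a)"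
    unfolding adpow_mult_top[OF ab] adpow_mult_top[OF ab(2,1)]
    by (simp add: binomial_symmetric[of j "i + j"] add.commute)
  then show ?thesis by (simp add: adker_def adpow_diff add.commute)
qed

section \<open>Constants of the Weyl algebra\<close>

lemma weyl_const_add: "weyl_const (c + d) = weyl_const c + weyl_const d"
  by transfer (rule weq_const_add)

lemma weyl_const_mult: "weyl_const (c * d) = weyl_const c * weyl_const d"
  by transfer (rule weq_const_mul)

lemma weyl_const_0 [simp]: "weyl_const 0 = 0"
  by transfer (rule weq_refl)

lemma weyl_const_1 [simp]: "weyl_const 1 = 1"
  by transfer (rule weq_refl)

lemma weyl_const_commute: "weyl_const c * a = a * weyl_const c"
  by transfer (rule weq_const_central)

lemma weyl_const_minus: "weyl_const (- c) = - weyl_const c"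
  using weyl_const_add[of c "- c"] by (simp add: eq_neg_iff_add_eq_0 add.commute)

lemma weyl_const_of_nat: "weyl_const (of_nat n) = of_nat n"
  by (induction n) (simp_all add: weyl_const_add)

lemma ad_weyl_const [simp]: "ad u (weyl_const c) = 0"
  by (simp add: ad_def weyl_const_commute)

lemma adpow_weyl_const_mult: "(ad u ^^ n) (weyl_const c * a) = weyl_const c * (ad u ^^ n) a"
  by (simp add: adpow_mult_commuting)

lemma adker_weyl_const_mult: "a \<in> adker u n \<Longrightarrow> weyl_const c * a \<in> adker u n"
  by (simp add: adker_def adpow_weyl_const_mult)

text \<open>Every element is the class of a formal expression, so structural induction on
  expressions descends to the quotient.\<close>

lemma weyl_induct [case_names const X Y add mult]:
  assumes "\<And>c. P (weyl_const c)" "P weyl_X" "P weyl_Y"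
    "\<And>a b. P a \<Longrightarrow> P b \<Longrightarrow> P (a + b)" "\<And>a b. P a \<Longrightarrow> P b \<Longrightarrow> P (a * b)"
  shows "P (a :: 'k::field weyl)"
proof (induction a rule: weyl.abs_induct)
  case (1 e)
  show ?case
  proof (induction e)
    case (WConst c)
    then show ?case using assms(1) by (simp add: weyl_const_def)
  next
    case WX
    then show ?case using assms(2) by (simp add: weyl_X_def)
  next
    case WY
    then show ?case using assms(3) by (simp add: weyl_Y_def)
  next
    case (WAdd a b)
    then show ?case using assms(4) by (metis plus_weyl.abs_eq)
  next
    case (WMul a b)
    then show ?case using assms(5) by (metis times_weyl.abs_eq)
  qed
qed

section \<open>The associated graded algebra\<close>

lemma coset_eq_iff:
  fixes a b :: "'a::ring_1"
  shows "{a} + adker u n = {b} + adker u n \<longleftrightarrow> a - b \<in> adker u n"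
proof
  assume "{a} + adker u n = {b} + adker u n"
  moreover have "a \<in> {a} + adker u n"
    using set_plus_intro[of a "{a}" 0 "adker u n"] by simp
  ultimately show "a - b \<in> adker u n"
    by (auto elim!: set_plus_elim)
next
  assume *: "a - b \<in> adker u n"
  have "{a} + adker u n \<subseteq> {b} + adker u n" if "a - b \<in> adker u n" for a b
  proof
    fix z assume "z \<in> {a} + adker u n"
    then obtain k where "z = a + k" "k \<in> adker u n" by (auto elim!: set_plus_elim)
    then have "z = b + ((a - b) + k)" "(a - b) + k \<in> adker u n"
      using that by (auto intro: adker_add)
    then show "z \<in> {b} + adker u n" by blast
  qed
  from this[OF *] this[of b a] * show "{a} + adker u n = {b} + adker u n"
    using adker_minus_iff by blast
qed

lemma coset_add:
  "({a} + adker u n) + ({b} + adker u n) = {a + b} + adker u n"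
proof -
  have "adker u n + adker u n = adker u n"
    using zero_in_adker[of u n] by (force simp: set_plus_def intro: adker_add)
  moreover have "{a} + {b} = {a + b}" by (auto simp: set_plus_def)
  ultimately show ?thesis by (metis (no_types) add.assoc add.left_commute)
qed

lemma coset_sum:
  fixes f :: "nat \<Rightarrow> 'a::ring_1"
  shows "(\<Sum>i\<le>m. {f i} + adker u n) = {\<Sum>i\<le>m. f i} + adker u n"
  by (induction m) (simp_all add: coset_add)

text \<open>In \<open>(a + k) * (b + l) = a * b + (a * l + k * (b + l))\<close> the error terms lie
  in the step that is factored out.\<close>

lemma coset_mult:
  fixes u :: "'a::ring_1"
  assumes "a \<in> adker u (Suc i)" "b \<in> adker u (Suc j)"
  shows "({a} + adker u i) * ({b} + adker u j) + adker u (i + j) = {a * b} + adker u (i + j)"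
    (is "?L = ?R")
proof
  show "?L \<subseteq> ?R"
  proof
    fix z assume "z \<in> ?L"
    then obtain k l m where klm: "z = (a + k) * (b + l) + m"
        "k \<in> adker u i" "l \<in> adker u j" "m \<in> adker u (i + j)"
      by (auto simp: set_plus_def set_times_def)
    have "b + l \<in> adker u (Suc j)"
      using assms klm adker_mono[of j "Suc j" u] by (auto intro: adker_add)
    then have "a * l \<in> adker u (i + j)" "k * (b + l) \<in> adker u (i + j)"
      using assms klm adker_mult_left adker_mult_right by blast+
    then have "a * l + k * (b + l) + m \<in> adker u (i + j)"
      using klm by (intro adker_add) auto
    moreover have "z = a * b + (a * l + k * (b + l) + m)"
      using klm by (simp add: algebra_simps)
    ultimately show "z \<in> ?R" by blast
  qed
  have "a * b \<in> ({a} + adker u i) * ({b} + adker u j)"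
    using set_plus_intro[of a "{a}" 0 "adker u i"] set_plus_intro[of b "{b}" 0 "adker u j"]
    by (auto simp: set_times_def)
  then show "?R \<subseteq> ?L" by (intro set_plus_mono2) auto
qed

lemma coset_smult:
  assumes "a \<in> adker u (Suc i)"
  shows "{weyl_const c} * ({a} + adker u i) + adker u i = {weyl_const c * a} + adker u i"
proof -
  have "weyl_const c \<in> adker u (Suc 0)" by (simp add: adker_def)
  from coset_mult[OF this assms] show ?thesis by simp
qed

text \<open>Families of representatives are multiplied by convolution, that is, as power series; the
  relevant ones are the elements of the Rees ring of the filtration.\<close>

definition rees :: "'k::field weyl \<Rightarrow> 'k weyl fps set" where
  "rees u = {f. (\<forall>i. fps_nth f i \<in> adker u (Suc i)) \<and> finite {i. fps_nth f i \<noteq> 0}}"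

definition graded_class :: "'k::field weyl \<Rightarrow> 'k weyl fps \<Rightarrow> nat \<Rightarrow> 'k weyl set" where
  "graded_class u f = (\<lambda>i. {fps_nth f i} + adker u i)"

lemma graded_class_eq_iff:
  "graded_class u f = graded_class u g \<longleftrightarrow> (\<forall>i. fps_nth f i - fps_nth g i \<in> adker u i)"
  by (simp add: graded_class_def fun_eq_iff coset_eq_iff)

lemma rees_zero: "0 \<in> rees u"
  by (simp add: rees_def)

lemma rees_one: "1 \<in> rees u"
proof -
  have "fps_nth 1 i \<in> adker u (Suc i)" for i
    by (cases i) (simp_all add: one_in_adker)
  moreover have "finite {i. fps_nth (1 :: 'a weyl fps) i \<noteq> 0}"
    by (rule finite_subset[of _ "{0}"]) auto
  ultimately show ?thesis by (simp add: rees_def)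
qed

lemma rees_add: "f \<in> rees u \<Longrightarrow> g \<in> rees u \<Longrightarrow> f + g \<in> rees u"
  by (auto simp: rees_def intro: adker_add
      intro: finite_subset[of _ "{i. fps_nth f i \<noteq> 0} \<union> {i. fps_nth g i \<noteq> 0}"])

lemma rees_minus: "f \<in> rees u \<Longrightarrow> - f \<in> rees u"
  by (auto simp: rees_def intro: adker_minus)

lemma rees_mult:
  assumes "f \<in> rees u" "g \<in> rees u"
  shows "f * g \<in> rees u"
proof -
  obtain M where M: "\<And>i. fps_nth f i \<noteq> 0 \<Longrightarrow> i \<le> M"
    using assms(1) by (auto simp: rees_def finite_nat_set_iff_bounded_le)
  obtain N where N: "\<And>i. fps_nth g i \<noteq> 0 \<Longrightarrow> i \<le> N"
    using assms(2) by (auto simp: rees_def finite_nat_set_iff_bounded_le)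
  have "fps_nth (f * g) i = 0" if "i > M + N" for i
    unfolding fps_mult_nth
  proof (intro sum.neutral ballI)
    fix k assume "k \<in> {0..i}"
    then have "k > M \<or> i - k > N" using that by auto
    then show "fps_nth f k * fps_nth g (i - k) = 0" using M[of k] N[of "i - k"] by fastforce
  qed
  then have "{i. fps_nth (f * g) i \<noteq> 0} \<subseteq> {..M + N}" using not_le_imp_less by blast
  then have "finite {i. fps_nth (f * g) i \<noteq> 0}" by (rule finite_subset) simp
  moreover have "fps_nth (f * g) i \<in> adker u (Suc i)" for i
    unfolding fps_mult_nth
  proof (intro adker_sum)
    fix k assume "k \<in> {0..i}"
    then show "fps_nth f k * fps_nth g (i - k) \<in> adker u (Suc i)"
      using assms adker_mult[of "fps_nth f k" u k "fps_nth g (i - k)" "i - k"]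
      by (auto simp: rees_def)
  qed
  ultimately show ?thesis by (simp add: rees_def)
qed

lemma rees_smult:
  assumes "f \<in> rees u"
  shows "fps_const (weyl_const c) * f \<in> rees u"
proof -
  have "{i. weyl_const c * fps_nth f i \<noteq> 0} \<subseteq> {i. fps_nth f i \<noteq> 0}" by auto
  then show ?thesis
    using assms by (auto simp: rees_def adker_weyl_const_mult intro: finite_subset)
qed

lemma graded_carrier: "carrier (graded_algebra u) = graded_class u ` rees u"
proof
  show "graded_class u ` rees u \<subseteq> carrier (graded_algebra u)"
  proof
    fix g assume "g \<in> graded_class u ` rees u"
    then obtain f where f: "f \<in> rees u" "g = graded_class u f" by auto
    have "{i. {fps_nth f i} + adker u i \<noteq> adker u i} \<subseteq> {i. fps_nth f i \<noteq> 0}" by auto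
    then show "g \<in> carrier (graded_algebra u)"
      using f by (auto simp: graded_algebra_def nil_filt_eq_adker graded_class_def rees_def
          intro: finite_subset)
  qed
  show "carrier (graded_algebra u) \<subseteq> graded_class u ` rees u"
  proof
    fix g assume "g \<in> carrier (graded_algebra u)"
    then have g: "\<forall>i. \<exists>a\<in>adker u (Suc i). g i = {a} + adker u i"
      and fin: "finite {i. g i \<noteq> adker u i}"
      by (auto simp: graded_algebra_def nil_filt_eq_adker)
    from g obtain a where a: "\<And>i. a i \<in> adker u (Suc i)" "\<And>i. g i = {a i} + adker u i"
      by metis
    \<comment> \<open>Trivial cosets get the representative 0, which keeps the support
      finite.\<close>
    define f where "f = Abs_fps (\<lambda>i. if g i = adker u i then 0 else a i)"
    have "{i. fps_nth f i \<noteq> 0} \<subseteq> {i. g i \<noteq> adker u i}" by (auto simp: f_def)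
    then have "f \<in> rees u" using fin a by (auto simp: rees_def f_def intro: finite_subset)
    moreover have "g = graded_class u f"
    proof
      fix i show "g i = graded_class u f i"
        using a(2)[of i] by (simp add: graded_class_def f_def)
    qed
    ultimately show "g \<in> graded_class u ` rees u" by blast
  qed
qed

section \<open>Operations of the graded algebra computed on representatives\<close>

lemma graded_zero: "\<zero>\<^bsub>graded_algebra u\<^esub> = graded_class u 0"
  by (simp add: graded_algebra_def graded_class_def nil_filt_eq_adker)

lemma graded_one: "\<one>\<^bsub>graded_algebra u\<^esub> = graded_class u 1"
  by (auto simp: graded_algebra_def graded_class_def nil_filt_eq_adker fun_eq_iff)

lemma graded_add:
  "graded_class u f \<oplus>\<^bsub>graded_algebra u\<^esub> graded_class u g = graded_class u (f + g)"
  by (simp add: graded_algebra_def graded_class_def coset_add)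

lemma graded_smult:
  assumes "f \<in> rees u"
  shows "c \<odot>\<^bsub>graded_algebra u\<^esub> graded_class u f = graded_class u (fps_const (weyl_const c) * f)"
  using assms
  by (simp add: graded_algebra_def graded_class_def nil_filt_eq_adker coset_smult rees_def)

lemma graded_mult:
  assumes "f \<in> rees u" "g \<in> rees u"
  shows "graded_class u f \<otimes>\<^bsub>graded_algebra u\<^esub> graded_class u g = graded_class u (f * g)"
proof
  fix n
  have "(\<Sum>i\<le>n. ({fps_nth f i} + adker u i) * ({fps_nth g (n - i)} + adker u (n - i)) + adker u n) =
      (\<Sum>i\<le>n. {fps_nth f i * fps_nth g (n - i)} + adker u n)"
  proof (rule sum.cong)
    fix i assume "i \<in> {..n}"
    then show "({fps_nth f i} + adker u i) * ({fps_nth g (n - i)} + adker u (n - i)) + adker u n =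
        {fps_nth f i * fps_nth g (n - i)} + adker u n"
      using assms coset_mult[of "fps_nth f i" u i "fps_nth g (n - i)" "n - i"]
      by (auto simp: rees_def)
  qed simp
  then show "(graded_class u f \<otimes>\<^bsub>graded_algebra u\<^esub> graded_class u g) n = graded_class u (f * g) n"
    by (simp add: graded_algebra_def graded_class_def nil_filt_eq_adker coset_sum fps_mult_nth
        flip: atMost_atLeast0)
qed

lemmas graded_simps = graded_zero graded_one graded_add graded_smult graded_mult
lemmas rees_closed = rees_zero rees_one rees_add rees_minus rees_mult rees_smult

lemma carrier_base_field [simp]: "carrier base_field = (UNIV :: 'k::field set)"
  and base_field_ops [simp]: "x \<oplus>\<^bsub>base_field\<^esub> y = x + y" "x \<otimes>\<^bsub>base_field\<^esub> y = x * y"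
    "\<one>\<^bsub>base_field\<^esub> = (1 :: 'k)"
  by (simp_all add: ring_of_type_algebra_def)

text \<open>All axioms except commutativity are inherited from power series along the surjection
  \<open>graded_class u\<close>. Commutativity comes from \<open>adker_commutator\<close>, applied
  to each pair of coefficients.\<close>

lemma graded_cring:
  assumes comm: "\<And>a b. ad u a = 0 \<Longrightarrow> ad u b = 0 \<Longrightarrow> a * b = b * a"
  shows "cring (graded_algebra u)"
proof (rule cringI)
  show "abelian_group (graded_algebra u)"
  proof (rule abelian_groupI)
    fix x assume "x \<in> carrier (graded_algebra u)"
    then obtain f where "f \<in> rees u" "x = graded_class u f" by (auto simp: graded_carrier)
    then have "- f \<in> rees u" "graded_class u (- f) \<oplus>\<^bsub>graded_algebra u\<^esub> x = \<zero>\<^bsub>graded_algebra u\<^esub>"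
      by (auto simp: rees_closed graded_simps)
    then show "\<exists>y\<in>carrier (graded_algebra u). y \<oplus>\<^bsub>graded_algebra u\<^esub> x = \<zero>\<^bsub>graded_algebra u\<^esub>"
      by (auto simp: graded_carrier)
  qed (auto simp: graded_carrier graded_simps rees_closed add_ac)
  show "comm_monoid (graded_algebra u)"
  proof (rule comm_monoidI)
    fix x y assume "x \<in> carrier (graded_algebra u)" "y \<in> carrier (graded_algebra u)"
    then obtain f g where fg: "f \<in> rees u" "x = graded_class u f" "g \<in> rees u" "y = graded_class u g"
      by (auto simp: graded_carrier)
    have "fps_nth (f * g) n - fps_nth (g * f) n \<in> adker u n" for n
    proof -
      \<comment> \<open>Reversing the order of summation puts each product opposite the one with its
        factors exchanged.\<close>
      have "fps_nth (g * f) n = (\<Sum>i=0..n. fps_nth g (n - i) * fps_nth f i)"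
        unfolding fps_mult_nth
        by (rule sum.reindex_bij_witness[of _ "\<lambda>i. n - i" "\<lambda>i. n - i"]) auto
      then have "fps_nth (f * g) n - fps_nth (g * f) n =
          (\<Sum>i=0..n. fps_nth f i * fps_nth g (n - i) - fps_nth g (n - i) * fps_nth f i)"
        by (simp add: fps_mult_nth sum_subtractf)
      also have "\<dots> \<in> adker u n"
      proof (rule adker_sum)
        fix i assume "i \<in> {0..n}"
        then show "fps_nth f i * fps_nth g (n - i) - fps_nth g (n - i) * fps_nth f i \<in> adker u n"
          using fg adker_commutator[OF comm, where a = "fps_nth f i" and i = i
            and b = "fps_nth g (n - i)" and j = "n - i"]
          by (auto simp: rees_def)
      qed
      finally show ?thesis .
    qed
    then show "x \<otimes>\<^bsub>graded_algebra u\<^esub> y = y \<otimes>\<^bsub>graded_algebra u\<^esub> x"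
      using fg by (simp add: graded_simps graded_class_eq_iff)
  qed (auto simp: graded_carrier graded_simps rees_closed mult.assoc)
qed (auto simp: graded_carrier graded_simps rees_closed distrib_right)

lemma assoc_algebraI:
  assumes "module R M" "ring M"
    and "\<And>a x y. \<lbrakk>a \<in> carrier R; x \<in> carrier M; y \<in> carrier M\<rbrakk> \<Longrightarrow>
        (a \<odot>\<^bsub>M\<^esub> x) \<otimes>\<^bsub>M\<^esub> y = a \<odot>\<^bsub>M\<^esub> (x \<otimes>\<^bsub>M\<^esub> y)"
    and "\<And>a x y. \<lbrakk>a \<in> carrier R; x \<in> carrier M; y \<in> carrier M\<rbrakk> \<Longrightarrow>
        x \<otimes>\<^bsub>M\<^esub> (a \<odot>\<^bsub>M\<^esub> y) = a \<odot>\<^bsub>M\<^esub> (x \<otimes>\<^bsub>M\<^esub> y)"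
  shows "assoc_algebra R M"
  using assms by (auto simp: assoc_algebra_def assoc_algebra_axioms_def)

lemma fps_const_weyl_const_commute:
  "f * fps_const (weyl_const c) = fps_const (weyl_const c) * f"
  by (rule fps_ext) (simp add: weyl_const_commute)

lemma graded_assoc_algebra:
  assumes "cring (graded_algebra u)"
  shows "assoc_algebra base_field (graded_algebra u)"
proof (rule assoc_algebraI)
  interpret cring "graded_algebra u" by fact
  show "ring (graded_algebra u)" by unfold_locales
  show "module base_field (graded_algebra u)"
    by (rule moduleI)
      (auto simp: graded_carrier graded_simps rees_closed cring_from_type_algebra is_abelian_group
        weyl_const_add weyl_const_mult distrib_left distrib_right mult.assoc
        simp flip: fps_const_add fps_const_mult)
  fix a x y
  assume "x \<in> carrier (graded_algebra u)" "y \<in> carrier (graded_algebra u)"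
  then show "(a \<odot>\<^bsub>graded_algebra u\<^esub> x) \<otimes>\<^bsub>graded_algebra u\<^esub> y =
      a \<odot>\<^bsub>graded_algebra u\<^esub> (x \<otimes>\<^bsub>graded_algebra u\<^esub> y)"
    and "x \<otimes>\<^bsub>graded_algebra u\<^esub> (a \<odot>\<^bsub>graded_algebra u\<^esub> y) =
      a \<odot>\<^bsub>graded_algebra u\<^esub> (x \<otimes>\<^bsub>graded_algebra u\<^esub> y)"
    by (auto simp: graded_carrier graded_simps rees_closed)
      (metis mult.assoc fps_const_weyl_const_commute)+
qed

section \<open>Difference operators\<close>

text \<open>Acting by difference operators on functions on the field, a homogeneous element is a shift
  followed by multiplication by a polynomial. The value \<open>False\<close> of the flag precomposes with
  the automorphism \<open>X \<mapsto> - Y\<close>, \<open>Y \<mapsto> X\<close>, which reverses the grading.\<close>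

fun wdiff :: "bool \<Rightarrow> 'k::field wexp \<Rightarrow> ('k \<Rightarrow> 'k) \<Rightarrow> 'k \<Rightarrow> 'k" where
  "wdiff s (WConst c) f = (\<lambda>z. c * f z)"
| "wdiff s WX f = (\<lambda>z. if s then f (z - 1) else - (z * f (z + 1)))"
| "wdiff s WY f = (\<lambda>z. if s then z * f (z + 1) else f (z - 1))"
| "wdiff s (WAdd a b) f = (\<lambda>z. wdiff s a f z + wdiff s b f z)"
| "wdiff s (WMul a b) f = wdiff s a (wdiff s b f)"

lemma wdiff_add: "wdiff s a (\<lambda>z. f z + g z) = (\<lambda>z. wdiff s a f z + wdiff s a g z)"
  by (induction a arbitrary: f g) (cases s; simp add: algebra_simps)+

lemma wdiff_smult: "wdiff s a (\<lambda>z. c * f z) = (\<lambda>z. c * wdiff s a f z)"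
  by (induction a arbitrary: f) (cases s; simp add: algebra_simps)+

lemma weq_wdiff: "weq a b \<Longrightarrow> wdiff s a f = wdiff s b f"
proof (induction arbitrary: f rule: weq.induct)
  case weq_add_neg
  then show ?case by (simp add: wdiff_smult)
next
  case weq_relation
  then show ?case by (cases s) (simp_all add: algebra_simps)
qed (simp_all add: wdiff_add wdiff_smult algebra_simps)

lift_definition weyl_diff :: "bool \<Rightarrow> 'k::field weyl \<Rightarrow> ('k \<Rightarrow> 'k) \<Rightarrow> 'k \<Rightarrow> 'k" is wdiff
  by (simp add: weq_wdiff fun_eq_iff)

text \<open>Collects what the two actions share, so that everything is proved once with
  \<open>x\<close> raising the degree by one. In both of them \<open>y * x\<close> acts as
  multiplication by the argument.\<close>

locale weyl_rep =
  fixes \<rho> :: "'k::field_char_0 weyl \<Rightarrow> ('k \<Rightarrow> 'k) \<Rightarrow> 'k \<Rightarrow> 'k" and x y :: "'k weyl"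
  assumes rep_add: "\<rho> (a + b) f z = \<rho> a f z + \<rho> b f z"
    and rep_mult: "\<rho> (a * b) f = \<rho> a (\<rho> b f)"
    and rep_const: "\<rho> (weyl_const c) f z = c * f z"
    and rep_x: "\<rho> x f z = f (z - 1)"
    and rep_y: "\<rho> y f z = z * f (z + 1)"
    and commutator: "y * x = x * y + 1"
    and generators_induct:
      "\<lbrakk>\<And>c. P (weyl_const c); P x; P y; \<And>a b. P a \<Longrightarrow> P b \<Longrightarrow> P (a + b);
        \<And>a b. P a \<Longrightarrow> P b \<Longrightarrow> P (a * b)\<rbrakk> \<Longrightarrow> P (e :: 'k weyl)"

lemma weyl_rep_True: "weyl_rep (weyl_diff True) weyl_X (weyl_Y :: 'k::field_char_0 weyl)"
proof
  show "weyl_Y * weyl_X = weyl_X * weyl_Y + (1 :: 'k weyl)"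
    using weyl_commutator by (simp add: algebra_simps)
  show "P e" if "\<And>c. P (weyl_const c)" "P weyl_X" "P weyl_Y" "\<And>a b. P a \<Longrightarrow> P b \<Longrightarrow> P (a + b)"
    "\<And>a b. P a \<Longrightarrow> P b \<Longrightarrow> P (a * b)" for P and e :: "'k weyl"
    using that by (rule weyl_induct)
qed (transfer; simp)+

lemma weyl_rep_False: "weyl_rep (weyl_diff False) weyl_Y (- weyl_X :: 'k::field_char_0 weyl)"
proof
  show "- weyl_X * weyl_Y = weyl_Y * - weyl_X + (1 :: 'k weyl)"
    using weyl_commutator by (simp add: algebra_simps)
  show "P e" if const: "\<And>c. P (weyl_const c)" and "P weyl_Y" and X: "P (- weyl_X)"
    and "\<And>a b. P a \<Longrightarrow> P b \<Longrightarrow> P (a + b)" and mult: "\<And>a b. P a \<Longrightarrow> P b \<Longrightarrow> P (a * b)"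
    for P and e :: "'k weyl"
  proof -
    \<comment> \<open>A scalar multiple of the generator \<open>- weyl_X\<close> gives back
      \<open>weyl_X\<close>.\<close>
    have "P (weyl_const (- 1) * - weyl_X)" by (intro mult const X)
    then have "P weyl_X" by (simp add: weyl_const_minus)
    show ?thesis by (rule weyl_induct[of P]) (fact that \<open>P weyl_X\<close>)+
  qed
qed (transfer; simp)+

section \<open>Homogeneous elements and their coefficient polynomials\<close>

context weyl_rep
begin

text \<open>Homogeneity is read off the action, which turns identities between homogeneous elements
  into identities between polynomials.\<close>

definition hom :: "int \<Rightarrow> 'k poly \<Rightarrow> 'k weyl \<Rightarrow> bool" where
  "hom m p a \<longleftrightarrow> (\<forall>f z. \<rho> a f z = poly p z * f (z - of_int m))"

definition grade :: "int \<Rightarrow> 'k weyl set" where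
  "grade m = {a. \<exists>p. hom m p a}"

abbreviation translate :: "int \<Rightarrow> 'k poly \<Rightarrow> 'k poly" where
  "translate m p \<equiv> p \<circ>\<^sub>p [:- of_int m, 1:]"

lemma rep_zero [simp]: "\<rho> 0 f z = 0"
  using rep_const[of 0 f z] by simp

lemma rep_minus: "\<rho> (- a) f z = - \<rho> a f z"
  using rep_add[of a "- a" f z] by (simp add: eq_neg_iff_add_eq_0 add.commute)

lemma rep_diff: "\<rho> (a - b) f z = \<rho> a f z - \<rho> b f z"
  using rep_add[of a "- b" f z] by (simp add: rep_minus)

lemma rep_sum: "\<rho> (\<Sum>i\<in>S. c i) f z = (\<Sum>i\<in>S. \<rho> (c i) f z)"
  by (induction S rule: infinite_finite_induct) (simp_all add: rep_add)

lemma hom_zero: "hom m 0 0"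
  by (simp add: hom_def)

lemma hom_add: "hom m p a \<Longrightarrow> hom m q b \<Longrightarrow> hom m (p + q) (a + b)"
  by (simp add: hom_def rep_add distrib_right)

lemma hom_diff: "hom m p a \<Longrightarrow> hom m q b \<Longrightarrow> hom m (p - q) (a - b)"
  by (simp add: hom_def rep_diff left_diff_distrib)

text \<open>Moving the shift by \<open>m\<close> past the coefficient of \<open>b\<close> translates
  that coefficient; this is the only source of noncommutativity among homogeneous elements.\<close>

lemma hom_mult: "hom m p a \<Longrightarrow> hom k q b \<Longrightarrow> hom (m + k) (p * translate m q) (a * b)"
  by (simp add: hom_def rep_mult poly_pcompose algebra_simps)

lemma hom_const: "hom 0 [:c:] (weyl_const c)"
  by (simp add: hom_def rep_const)

lemma hom_one: "hom 0 1 1"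
  using hom_const[of 1] by (simp add: one_pCons)

lemma hom_const_mult: "hom m p a \<Longrightarrow> hom m (smult c p) (weyl_const c * a)"
  using hom_mult[OF hom_const, of m p a c] by simp

lemma hom_x: "hom 1 1 x"
  by (simp add: hom_def rep_x)

lemma hom_y: "hom (- 1) [:0, 1:] y"
  by (simp add: hom_def rep_y)

lemma hom_x_power: "hom (int n) 1 (x ^ n)"
proof (induction n)
  case 0
  then show ?case using hom_one by simp
next
  case (Suc n)
  then show ?case using hom_mult[OF hom_x Suc] by (simp add: one_pCons pcompose_pCons)
qed

text \<open>The coefficient is the rising factorial z (z + 1) ... (z + n - 1), of which only the
  degree is needed.\<close>

lemma hom_y_power: "\<exists>p. p \<noteq> 0 \<and> degree p = n \<and> hom (- int n) p (y ^ n)"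
proof (induction n)
  case 0
  then show ?case using hom_one by (intro exI[of _ 1]) simp
next
  case (Suc n)
  then obtain p where p: "p \<noteq> 0" "degree p = n" "hom (- int n) p (y ^ n)" by blast
  then have "hom (- int (Suc n)) ([:0, 1:] * translate (- 1) p) (y ^ Suc n)"
    using hom_mult[OF hom_y p(3)] by (simp add: algebra_simps)
  moreover have "translate (- 1) p \<noteq> 0" using p by (simp add: pcompose_eq_0_iff)
  then have "[:0, 1:] * translate (- 1) p \<noteq> 0" "degree ([:0, 1:] * translate (- 1) p) = Suc n"
    using p by (simp_all add: degree_mult_eq degree_pcompose del: mult_pCons_left)
  ultimately show ?case by blast
qed

text \<open>Acting on the constant function 1 returns the values of the coefficient, and over an
  infinite field these determine a polynomial.\<close>

lemma hom_unique: "hom m p a \<Longrightarrow> hom m q a \<Longrightarrow> p = q"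
proof -
  assume "hom m p a" "hom m q a"
  then have "\<rho> a (\<lambda>_. 1) z = poly p z * 1" "\<rho> a (\<lambda>_. 1) z = poly q z * 1" for z
    unfolding hom_def by blast+
  then have "poly p z = poly q z" for z by simp
  then show ?thesis by (simp add: poly_eq_poly_eq_iff[symmetric] fun_eq_iff)
qed

section \<open>Polynomials in the degree zero element\<close>

definition h :: "'k weyl" where "h = y * x"

lemma h_eq: "x * y = h - 1" "x * h = (h - 1) * x" "y * h = (h + 1) * y"
proof -
  show *: "x * y = h - 1" using commutator by (simp add: h_def)
  have "x * h = (x * y) * x" by (simp add: h_def mult.assoc)
  then show "x * h = (h - 1) * x" by (simp only: *)
  have "y * h = y * (x * y + 1)" by (simp add: h_def commutator)
  then show "y * h = (h + 1) * y" by (simp add: h_def algebra_simps)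
qed

lemma hom_h: "hom 0 [:0, 1:] h"
  using hom_mult[OF hom_y hom_x] by (simp add: h_def one_pCons pcompose_pCons)

definition peval :: "'k poly \<Rightarrow> 'k weyl" where
  "peval p = fold_coeffs (\<lambda>c e. weyl_const c + h * e) p 0"

lemma peval_0 [simp]: "peval 0 = 0"
  by (simp add: peval_def)

lemma peval_pCons [simp]: "peval (pCons c p) = weyl_const c + h * peval p"
  by (cases "p = 0 \<and> c = 0") (auto simp: peval_def)

lemma peval_add: "peval (p + q) = peval p + peval q"
  by (induction p q rule: poly_induct2) (simp_all add: weyl_const_add algebra_simps)

lemma peval_smult: "peval (Polynomial.smult c p) = weyl_const c * peval p"
proof (induction p)
  case (pCons a p)
  have "weyl_const c * (h * peval p) = h * (weyl_const c * peval p)"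
    by (metis mult.assoc weyl_const_commute)
  with pCons show ?case by (simp add: weyl_const_mult distrib_left)
qed simp

lemma peval_mult: "peval (p * q) = peval p * peval q"
  by (induction p) (simp_all add: peval_add peval_smult algebra_simps)

lemma x_peval: "x * peval p = peval (translate 1 p) * x"
proof (induction p)
  case (pCons c p)
  have "x * peval (pCons c p) = weyl_const c * x + (x * h) * peval p"
    by (simp add: distrib_left weyl_const_commute mult.assoc)
  also have "\<dots> = weyl_const c * x + (h - 1) * (peval (translate 1 p) * x)"
    by (simp add: h_eq mult.assoc pCons)
  also have "\<dots> = (weyl_const c + (h - 1) * peval (translate 1 p)) * x"
    by (simp add: distrib_right mult.assoc)
  finally show ?case
    by (simp add: pcompose_pCons peval_add peval_mult weyl_const_minus algebra_simps
        del: mult_pCons_left)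
qed simp

lemma y_peval: "y * peval p = peval (translate (- 1) p) * y"
proof (induction p)
  case (pCons c p)
  have "y * peval (pCons c p) = weyl_const c * y + (y * h) * peval p"
    by (simp add: distrib_left weyl_const_commute mult.assoc)
  also have "\<dots> = weyl_const c * y + (h + 1) * (peval (translate (- 1) p) * y)"
    by (simp add: h_eq mult.assoc pCons)
  also have "\<dots> = (weyl_const c + (h + 1) * peval (translate (- 1) p)) * y"
    by (simp add: distrib_right mult.assoc)
  finally show ?case
    by (simp add: pcompose_pCons peval_add peval_mult weyl_const_minus algebra_simps
        del: mult_pCons_left)
qed simp

lemma hom_peval: "hom 0 p (peval p)"
proof (induction p)
  case (pCons c p)
  have "hom 0 ([:0, 1:] * p) (h * peval p)"
    using hom_mult[OF hom_h pCons(2)] by simp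
  from hom_add[OF hom_const this] have "hom 0 ([:c:] + [:0, 1:] * p) (weyl_const c + h * peval p)" .
  then show ?case by simp
qed (simp add: hom_zero)

section \<open>Normal forms and faithfulness of the action\<close>

definition v :: "int \<Rightarrow> 'k weyl" where
  "v m = (if m \<ge> 0 then x ^ nat m else y ^ nat (- m))"

lemma hom_v: "\<exists>p. p \<noteq> 0 \<and> hom m p (v m)"
  using hom_x_power[of "nat m"] hom_y_power[of "nat (- m)"] by (auto simp: v_def intro: exI[of _ 1])

definition normal :: "int \<Rightarrow> 'k weyl set" where
  "normal m = {peval p * v m |p. True}"

lemma normal_left: "e \<in> normal m \<Longrightarrow> peval p * e \<in> normal m"
  by (auto simp: normal_def mult.assoc[symmetric] peval_mult[symmetric])

lemma normal_add: "e \<in> normal m \<Longrightarrow> e' \<in> normal m \<Longrightarrow> e + e' \<in> normal m"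
  by (auto simp: normal_def distrib_right[symmetric] peval_add[symmetric])

lemma normal_zero: "0 \<in> normal m"
  unfolding normal_def using peval_0 by (metis (mono_tags, lifting) mem_Collect_eq mult_zero_left)

lemma v_in_normal: "v m \<in> normal m"
  unfolding normal_def by (auto intro!: exI[of _ 1] simp: one_pCons)

lemma normal_const: "e \<in> normal m \<Longrightarrow> weyl_const c * e \<in> normal m"
  using normal_left[of e m "[:c:]"] by simp

lemma normal_x:
  assumes "e \<in> normal m"
  shows "x * e \<in> normal (m + 1)"
proof -
  obtain p where p: "e = peval p * v m" using assms by (auto simp: normal_def)
  have "x * v m \<in> normal (m + 1)"
  proof (cases "m \<ge> 0")
    case True
    then have "x * v m = v (m + 1)" by (simp add: v_def nat_add_distrib)
    then show ?thesis using v_in_normal by simp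
  next
    case False
    then have "nat (- m) = Suc (nat (- (m + 1)))" by simp
    then have "v m = y * v (m + 1)" using False by (simp add: v_def)
    \<comment> \<open>The leading pair \<open>x * y\<close> equals \<open>h - 1\<close>, which is
      \<open>[:- 1, 1:]\<close> evaluated at \<open>h\<close>.\<close>
    then have "x * v m = peval [:- 1, 1:] * v (m + 1)"
      by (simp add: mult.assoc[symmetric] h_eq weyl_const_minus algebra_simps)
    then show ?thesis using normal_left[OF v_in_normal] by (simp del: peval_pCons)
  qed
  moreover have "x * e = peval (translate 1 p) * (x * v m)"
    unfolding p mult.assoc[symmetric] x_peval ..
  ultimately show ?thesis using normal_left by simp
qed

lemma normal_y:
  assumes "e \<in> normal m"
  shows "y * e \<in> normal (m - 1)"
proof -
  obtain p where p: "e = peval p * v m" using assms by (auto simp: normal_def)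
  have "y * v m \<in> normal (m - 1)"
  proof (cases "m \<le> 0")
    case True
    then have "nat (- (m - 1)) = Suc (nat (- m))" by simp
    then have "y * v m = v (m - 1)" using True by (auto simp: v_def)
    then show ?thesis using v_in_normal by simp
  next
    case False
    then have "nat m = Suc (nat (m - 1))" by simp
    then have "v m = x * v (m - 1)" using False by (simp add: v_def)
    then have "y * v m = peval [:0, 1:] * v (m - 1)"
      by (simp add: mult.assoc[symmetric] h_def)
    then show ?thesis using normal_left[OF v_in_normal] by (simp del: peval_pCons)
  qed
  moreover have "y * e = peval (translate (- 1) p) * (y * v m)"
    unfolding p mult.assoc[symmetric] y_peval ..
  ultimately show ?thesis using normal_left by simp
qed

definition normal_sum :: "'k weyl \<Rightarrow> bool" where
  "normal_sum a \<longleftrightarrow> (\<exists>S c. finite S \<and> (\<forall>m. c m \<in> normal m) \<and> a = (\<Sum>m\<in>S. c m))"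

lemma normal_sum_add:
  assumes "normal_sum a" "normal_sum b"
  shows "normal_sum (a + b)"
proof -
  obtain S c where c: "finite S" "\<And>m. c m \<in> normal m" "a = (\<Sum>m\<in>S. c m)"
    using assms by (auto simp: normal_sum_def)
  obtain T d where d: "finite T" "\<And>m. d m \<in> normal m" "b = (\<Sum>m\<in>T. d m)"
    using assms by (auto simp: normal_sum_def)
  have "a = (\<Sum>m\<in>S\<union>T. if m \<in> S then c m else 0)"
    unfolding c(3) using c(1) d(1) by (intro sum.mono_neutral_cong_left) auto
  moreover have "b = (\<Sum>m\<in>S\<union>T. if m \<in> T then d m else 0)"
    unfolding d(3) using c(1) d(1) by (intro sum.mono_neutral_cong_left) auto
  ultimately have "a + b = (\<Sum>m\<in>S\<union>T. (if m \<in> S then c m else 0) + (if m \<in> T then d m else 0))"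
    by (simp add: sum.distrib)
  then show ?thesis unfolding normal_sum_def
    using c d by (intro exI[of _ "S \<union> T"] exI conjI) (auto intro: normal_add normal_zero)
qed

lemma normal_sum_shift:
  assumes "normal_sum a" "\<And>e m. e \<in> normal m \<Longrightarrow> b * e \<in> normal (m + k)"
  shows "normal_sum (b * a)"
proof -
  obtain S c where c: "finite S" "\<And>m. c m \<in> normal m" "a = (\<Sum>m\<in>S. c m)"
    using assms by (auto simp: normal_sum_def)
  have "b * a = (\<Sum>m\<in>(\<lambda>m. m + k) ` S. b * c (m - k))"
    unfolding c(3) by (subst sum.reindex) (auto simp: sum_distrib_left)
  moreover have "b * c (m - k) \<in> normal m" for m
    using assms(2)[OF c(2), of "m - k"] by simp
  ultimately show ?thesis
    unfolding normal_sum_def using c(1)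
    by (intro exI[of _ "(\<lambda>m. m + k) ` S"] exI[of _ "\<lambda>m. b * c (m - k)"]) auto
qed

text \<open>Left multiplication by a generator shifts the components of a normal form. Keeping
  \<open>b\<close> arbitrary lets the product case apply the induction hypothesis twice, and
  \<open>b = 1\<close> shows that the components span the algebra.\<close>

lemma normal_sum_mult: "normal_sum b \<Longrightarrow> normal_sum (a * b)"
proof (induction a arbitrary: b rule: generators_induct)
  case (1 c)
  show ?case using normal_sum_shift[OF 1, of "weyl_const c" 0] normal_const by simp
next
  case 2
  show ?case using normal_sum_shift[OF 2, of x 1] normal_x by simp
next
  case 3
  show ?case using normal_sum_shift[OF 3, of y "- 1"] normal_y by simp
next
  case (4 a b)
  then show ?case by (simp add: distrib_right normal_sum_add)
next
  case (5 a b)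
  then show ?case by (simp add: mult.assoc)
qed

lemma normal_sum: "normal_sum a"
proof -
  have "v 0 = 1" by (simp add: v_def)
  then have "normal_sum 1" unfolding normal_sum_def
    using v_in_normal[of 0]
    by (intro exI[of _ "{0}"] exI[of _ "\<lambda>m. if m = 0 then 1 else 0"]) (auto simp: normal_zero)
  then show ?thesis using normal_sum_mult[of 1 a] by simp
qed

text \<open>The coefficient of \<open>peval p * v m\<close> is \<open>p\<close> times the nonzero
  coefficient of \<open>v m\<close>, so it vanishes only for \<open>p = 0\<close>.\<close>

lemma normal_hom_zero:
  assumes "e \<in> normal m" "hom m 0 e"
  shows "e = 0"
proof -
  obtain p where p: "e = peval p * v m" using assms by (auto simp: normal_def)
  obtain q where q: "q \<noteq> 0" "hom m q (v m)" using hom_v by blast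
  have "hom m (p * q) e" using hom_mult[OF hom_peval q(2)] p by simp
  then have "p * q = 0" using assms hom_unique by blast
  then show ?thesis using p q by simp
qed

lemma normal_grade: "normal m \<subseteq> grade m"
proof
  fix e assume "e \<in> normal m"
  then obtain p where p: "e = peval p * v m" by (auto simp: normal_def)
  obtain q where "hom m q (v m)" using hom_v by blast
  from hom_mult[OF hom_peval this, of p] p show "e \<in> grade m" by (auto simp: grade_def)
qed

text \<open>The indicator function of the point \<open>z - k\<close> isolates the summand of degree
  \<open>k\<close>, because distinct integers stay distinct in characteristic zero.\<close>

lemma hom_sum_eq_zero:
  assumes "finite S" "\<And>m. m \<in> S \<Longrightarrow> hom m (p m) (c m)" "\<And>f z. \<rho> (\<Sum>m\<in>S. c m) f z = 0" "k \<in> S"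
  shows "p k = 0"
proof -
  have "poly (p k) z = 0" for z
  proof -
    define f where "f = (\<lambda>w. if w = z - of_int k then 1 else 0 :: 'k)"
    have "0 = (\<Sum>m\<in>S. \<rho> (c m) f z)" using assms(3) by (simp add: rep_sum)
    also have "\<dots> = (\<Sum>m\<in>S. poly (p m) z * f (z - of_int m))"
      using assms(2) by (intro sum.cong) (auto simp: hom_def)
    also have "\<dots> = (\<Sum>m\<in>S. if m = k then poly (p m) z else 0)"
      by (intro sum.cong) (auto simp: f_def)
    also have "\<dots> = poly (p k) z" using assms by simp
    finally show ?thesis by simp
  qed
  then show ?thesis using poly_all_0_iff_0 by blast
qed

text \<open>If a sum of normal forms acts as zero, each of its coefficients vanishes, and a normal
  form with zero coefficient is zero.\<close>

lemma rep_faithful: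
  assumes "\<And>f z. \<rho> a f z = 0"
  shows "a = 0"
proof -
  obtain S c where c: "finite S" "\<And>m. c m \<in> normal m" "a = (\<Sum>m\<in>S. c m)"
    using normal_sum[of a] by (auto simp: normal_sum_def)
  have "\<forall>m. \<exists>p. hom m p (c m)" using c normal_grade by (auto simp: grade_def)
  then obtain p where p: "\<And>m. hom m (p m) (c m)" by metis
  have "c m = 0" if "m \<in> S" for m
  proof -
    have "p m = 0" using assms c p that by (intro hom_sum_eq_zero[of S p c]) auto
    then show ?thesis using p[of m] c normal_hom_zero by auto
  qed
  then show ?thesis using c by simp
qed

lemma hom_eq_zero_iff: "hom m p a \<Longrightarrow> a = 0 \<longleftrightarrow> p = 0"
proof
  assume "hom m p a" "a = 0"
  then show "p = 0" using hom_unique hom_zero by blast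
next
  assume "hom m p a" "p = 0"
  then show "a = 0" by (intro rep_faithful) (simp add: hom_def)
qed

section \<open>Decomposition into homogeneous components\<close>

lemma grade_zero [simp]: "0 \<in> grade m"
  using hom_zero by (auto simp: grade_def)

lemma grade_add: "a \<in> grade m \<Longrightarrow> b \<in> grade m \<Longrightarrow> a + b \<in> grade m"
  unfolding grade_def using hom_add by blast

lemma grade_diff: "a \<in> grade m \<Longrightarrow> b \<in> grade m \<Longrightarrow> a - b \<in> grade m"
  unfolding grade_def using hom_diff by blast

lemma grade_mult: "a \<in> grade m \<Longrightarrow> b \<in> grade k \<Longrightarrow> a * b \<in> grade (m + k)"
  unfolding grade_def using hom_mult by blast

lemma grade_sum_eq_zero:
  assumes "finite S" "\<And>m. c m \<in> grade m" "(\<Sum>m\<in>S. c m) = 0" "k \<in> S"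
  shows "c k = 0"
proof -
  have "\<forall>m. \<exists>p. hom m p (c m)" using assms by (auto simp: grade_def)
  then obtain p where p: "\<And>m. hom m (p m) (c m)" by metis
  have "p k = 0" using assms p by (intro hom_sum_eq_zero[of S p c]) auto
  then show ?thesis using p[of k] hom_eq_zero_iff by simp
qed

definition decomposition :: "'k weyl \<Rightarrow> (int \<Rightarrow> 'k weyl) \<Rightarrow> bool" where
  "decomposition a c \<longleftrightarrow> (\<forall>m. c m \<in> grade m) \<and>
    (\<exists>S. finite S \<and> (\<forall>m. m \<notin> S \<longrightarrow> c m = 0) \<and> a = (\<Sum>m\<in>S. c m))"

lemma decompositionI:
  "\<lbrakk>\<And>m. c m \<in> grade m; finite S; \<And>m. m \<notin> S \<Longrightarrow> c m = 0; a = (\<Sum>m\<in>S. c m)\<rbrakk> \<Longrightarrow> decomposition a c"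
  unfolding decomposition_def by blast

lemma decomposition_superset:
  assumes "decomposition a c"
  obtains S where "finite S" "\<And>m. m \<notin> S \<Longrightarrow> c m = 0"
    "\<And>T. finite T \<Longrightarrow> S \<subseteq> T \<Longrightarrow> a = (\<Sum>m\<in>T. c m)"
proof -
  obtain S where S: "finite S" "\<And>m. m \<notin> S \<Longrightarrow> c m = 0" "a = (\<Sum>m\<in>S. c m)"
    using assms by (auto simp: decomposition_def)
  have "a = (\<Sum>m\<in>T. c m)" if "finite T" "S \<subseteq> T" for T
    unfolding S(3) using that S by (intro sum.mono_neutral_left) auto
  then show ?thesis using that S by blast
qed

lemma decomposition_unique:
  assumes "decomposition a c" "decomposition a d"
  shows "c = d"
proof
  fix k
  obtain S where S: "finite S" "\<And>T. finite T \<Longrightarrow> S \<subseteq> T \<Longrightarrow> a = (\<Sum>m\<in>T. c m)"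
    using decomposition_superset[OF assms(1)] by metis
  obtain T where T: "finite T" "\<And>S. finite S \<Longrightarrow> T \<subseteq> S \<Longrightarrow> a = (\<Sum>m\<in>S. d m)"
    using decomposition_superset[OF assms(2)] by metis
  have fin: "finite (insert k (S \<union> T))" using S T by simp
  have "a = (\<Sum>m\<in>insert k (S \<union> T). c m)" using fin S by blast
  moreover have "a = (\<Sum>m\<in>insert k (S \<union> T). d m)" using fin T by blast
  ultimately have "(\<Sum>m\<in>insert k (S \<union> T). c m - d m) = 0"
    by (simp add: sum_subtractf)
  then have "c k - d k = 0"
    using assms S(1) T(1)
    by (intro grade_sum_eq_zero[of "insert k (S \<union> T)" "\<lambda>m. c m - d m" k])
      (auto simp: decomposition_def intro: grade_diff)
  then show "c k = d k" by simp
qed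

lemma decomposition_exists: "\<exists>c. decomposition a c"
proof -
  obtain S c where c: "finite S" "\<And>m. c m \<in> normal m" "a = (\<Sum>m\<in>S. c m)"
    using normal_sum[of a] by (auto simp: normal_sum_def)
  then have "decomposition a (\<lambda>m. if m \<in> S then c m else 0)"
    using normal_grade by (intro decompositionI[of _ S]) (auto intro: sum.cong)
  then show ?thesis by blast
qed

definition comp :: "'k weyl \<Rightarrow> int \<Rightarrow> 'k weyl" where
  "comp a = (THE c. decomposition a c)"

lemma decomposition_comp: "decomposition a (comp a)"
  unfolding comp_def using decomposition_exists decomposition_unique by (metis theI)

lemma comp_eqI: "decomposition a c \<Longrightarrow> comp a = c"
  using decomposition_comp decomposition_unique by blast

lemma comp_in_grade [simp]: "comp a m \<in> grade m"
  using decomposition_comp by (auto simp: decomposition_def)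

lemma finite_comp: "finite {m. comp a m \<noteq> 0}"
proof -
  obtain S where "finite S" "\<And>m. m \<notin> S \<Longrightarrow> comp a m = 0"
    using decomposition_superset[OF decomposition_comp] by metis
  then show ?thesis by (auto intro: finite_subset[of _ S])
qed

lemma sum_comp:
  assumes "finite T" "{m. comp a m \<noteq> 0} \<subseteq> T"
  shows "(\<Sum>m\<in>T. comp a m) = a"
proof -
  obtain S where S: "finite S" "\<And>T. finite T \<Longrightarrow> S \<subseteq> T \<Longrightarrow> a = (\<Sum>m\<in>T. comp a m)"
    using decomposition_superset[OF decomposition_comp] by metis
  have "(\<Sum>m\<in>T. comp a m) = (\<Sum>m\<in>S\<union>T. comp a m)"
    using assms S by (intro sum.mono_neutral_left) auto
  then show ?thesis using S(2)[of "S \<union> T"] S(1) assms(1) by simp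
qed

lemma comp_grade: "a \<in> grade k \<Longrightarrow> comp a m = (if m = k then a else 0)"
  using comp_eqI[of a "\<lambda>m. if m = k then a else 0"] decompositionI[of "\<lambda>m. if m = k then a else 0" "{k}" a]
  by simp

lemma comp_zero [simp]: "comp 0 m = 0"
  using comp_grade[OF grade_zero] by simp

lemma comp_add: "comp (a + b) m = comp a m + comp b m"
proof -
  define S where "S = {m. comp a m \<noteq> 0} \<union> {m. comp b m \<noteq> 0}"
  have S: "finite S" using finite_comp by (simp add: S_def)
  have "a + b = (\<Sum>m\<in>S. comp a m + comp b m)"
    using S by (simp add: sum.distrib sum_comp S_def)
  then have "decomposition (a + b) (\<lambda>m. comp a m + comp b m)"
    using S by (intro decompositionI[of _ S]) (auto simp: S_def intro: grade_add)
  then show ?thesis using comp_eqI by metis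
qed

lemma comp_sum: "comp (\<Sum>i\<in>I. f i) m = (\<Sum>i\<in>I. comp (f i) m)"
  by (induction I rule: infinite_finite_induct) (simp_all add: comp_add)

lemma comp_grade_mult:
  assumes "e \<in> grade k"
  shows "comp (e * a) m = e * comp a (m - k)" "comp (a * e) m = comp a (m - k) * e"
proof -
  let ?S = "{m. comp a m \<noteq> 0}"
  have *: "(\<Sum>m\<in>(\<lambda>m. m + k) ` ?S. comp a (m - k)) = a"
    by (subst sum.reindex) (auto simp: sum_comp finite_comp)
  have "decomposition (e * a) (\<lambda>m. e * comp a (m - k))"
  proof (rule decompositionI)
    show "e * comp a (m - k) \<in> grade m" for m
      using grade_mult[OF assms comp_in_grade[of a "m - k"]] by simp
    show "e * a = (\<Sum>m\<in>(\<lambda>m. m + k) ` ?S. e * comp a (m - k))"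
      using * by (simp add: sum_distrib_left[symmetric])
    fix m assume "m \<notin> (\<lambda>m. m + k) ` ?S"
    then have "comp a (m - k) = 0" by (metis (mono_tags, lifting) diff_add_cancel image_eqI mem_Collect_eq)
    then show "e * comp a (m - k) = 0" by simp
  qed (simp add: finite_comp)
  then show "comp (e * a) m = e * comp a (m - k)" using comp_eqI by metis
  have "decomposition (a * e) (\<lambda>m. comp a (m - k) * e)"
  proof (rule decompositionI)
    show "comp a (m - k) * e \<in> grade m" for m
      using grade_mult[OF comp_in_grade[of a "m - k"] assms] by simp
    show "a * e = (\<Sum>m\<in>(\<lambda>m. m + k) ` ?S. comp a (m - k) * e)"
      using * by (simp add: sum_distrib_right[symmetric])
    fix m assume "m \<notin> (\<lambda>m. m + k) ` ?S"
    then have "comp a (m - k) = 0" by (metis (mono_tags, lifting) diff_add_cancel image_eqI mem_Collect_eq)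
    then show "comp a (m - k) * e = 0" by simp
  qed (simp add: finite_comp)
  then show "comp (a * e) m = comp a (m - k) * e" using comp_eqI by metis
qed

lemma const_in_grade: "weyl_const c \<in> grade 0"
  using hom_const by (auto simp: grade_def)

lemma comp_const_mult: "comp (weyl_const c * a) m = weyl_const c * comp a m"
  using comp_grade_mult(1)[OF const_in_grade] by simp

lemma comp_minus: "comp (- a) m = - comp a m"
  using comp_add[of a "- a" m] by (simp add: eq_neg_iff_add_eq_0 add.commute)

lemma comp_diff: "comp (a - b) m = comp a m - comp b m"
  using comp_add[of a "- b" m] by (simp add: comp_minus)

lemma comp_mult: "comp (a * b) m = (\<Sum>i | comp a i \<noteq> 0. comp a i * comp b (m - i))"
proof -
  have "a * b = (\<Sum>i | comp a i \<noteq> 0. comp a i * b)"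
    using sum_comp[OF finite_comp subset_refl, of a] by (metis sum_distrib_right)
  then show ?thesis by (simp add: comp_sum comp_grade_mult(1)[OF comp_in_grade])
qed

lemma eqI_comp: "(\<And>m. comp a m = comp b m) \<Longrightarrow> a = b"
  using sum_comp[OF finite_comp subset_refl, of a] sum_comp[OF finite_comp subset_refl, of b]
  by (metis (mono_tags, lifting) Collect_cong sum.cong)

lemma grade_mult_nonzero:
  assumes "a \<in> grade m" "b \<in> grade k" "a \<noteq> 0" "b \<noteq> 0"
  shows "a * b \<noteq> 0"
proof -
  obtain p q where pq: "hom m p a" "hom k q b" using assms by (auto simp: grade_def)
  then have "p \<noteq> 0" "q \<noteq> 0" using assms hom_eq_zero_iff by auto
  then have "p * translate m q \<noteq> 0" by (simp add: pcompose_eq_0_iff)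
  then show ?thesis using hom_eq_zero_iff[OF hom_mult[OF pq]] by simp
qed

section \<open>Leading components and absence of zero divisors\<close>

definition top_degree :: "'k weyl \<Rightarrow> int \<Rightarrow> bool" where
  "top_degree a m \<longleftrightarrow> comp a m \<noteq> 0 \<and> (\<forall>k>m. comp a k = 0)"

lemma top_degree_exists:
  assumes "a \<noteq> 0"
  shows "\<exists>m. top_degree a m"
proof -
  have "{m. comp a m \<noteq> 0} \<noteq> {}" using assms eqI_comp[of a 0] by auto
  then have "comp a (Max {m. comp a m \<noteq> 0}) \<noteq> 0" using finite_comp Max_in by blast
  moreover have "comp a k = 0" if "k > Max {m. comp a m \<noteq> 0}" for k
    using that finite_comp[of a] Max_ge[of "{m. comp a m \<noteq> 0}" k] by fastforce
  ultimately show ?thesis unfolding top_degree_def by blast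
qed

lemma top_degree_nonzero: "top_degree a m \<Longrightarrow> a \<noteq> 0"
  by (auto simp: top_degree_def)

text \<open>Only the two leading components meet in degree \<open>m + k\<close>, and a product of
  nonzero homogeneous elements is nonzero. Therefore there are no zero divisors.\<close>

lemma top_degree_mult:
  assumes "top_degree a m" "top_degree b k"
  shows "top_degree (a * b) (m + k)"
proof -
  have "comp (a * b) (m + k) = (\<Sum>i\<in>{m}. comp a i * comp b (m + k - i))"
    unfolding comp_mult
  proof (rule sum.mono_neutral_right)
    show "\<forall>i\<in>{m. comp a m \<noteq> 0} - {m}. comp a i * comp b (m + k - i) = 0"
    proof
      fix i assume i: "i \<in> {m. comp a m \<noteq> 0} - {m}"
      then have "i \<le> m" using assms(1) by (auto simp: top_degree_def intro: leI)
      then have "m + k - i > k" using i by auto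
      then show "comp a i * comp b (m + k - i) = 0" using assms(2) by (simp add: top_degree_def)
    qed
  qed (use assms finite_comp in \<open>auto simp: top_degree_def\<close>)
  moreover have "comp a m * comp b k \<noteq> 0"
    using assms by (intro grade_mult_nonzero[of _ m _ k]) (auto simp: top_degree_def)
  moreover have "comp (a * b) l = 0" if "l > m + k" for l
    unfolding comp_mult
  proof (rule sum.neutral, rule ballI)
    fix i assume "i \<in> {i. comp a i \<noteq> 0}"
    then have "i \<le> m" using assms(1) by (auto simp: top_degree_def intro: leI)
    then have "l - i > k" using that by auto
    then show "comp a i * comp b (l - i) = 0" using assms(2) by (simp add: top_degree_def)
  qed
  ultimately show ?thesis by (simp add: top_degree_def)
qed

lemma mult_nonzero:
  fixes a b :: "'k weyl"
  assumes "a \<noteq> 0" "b \<noteq> 0"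
  shows "a * b \<noteq> 0"
proof -
  obtain m k where "top_degree a m" "top_degree b k" using assms top_degree_exists by blast
  then show ?thesis using top_degree_mult top_degree_nonzero by blast
qed

text \<open>Functions that vanish at the nonpositive integers form a submodule, so the coefficient of a
  homogeneous element of degree \<open>m < 0\<close> vanishes at \<open>0, - 1, \<dots>, m + 1\<close>.\<close>

lemma rep_vanishing:
  assumes "\<And>j. f (- of_nat j) = 0"
  shows "\<rho> a f (- of_nat j) = 0"
  using assms
proof (induction a arbitrary: f j rule: generators_induct)
  case 2
  have "- of_nat j - 1 = (- of_nat (Suc j) :: 'k)" by simp
  then show ?case using 2 by (metis rep_x)
next
  case 3
  show ?case
  proof (cases j)
    case (Suc i)
    then have "- of_nat j + 1 = (- of_nat i :: 'k)" by simp
    then show ?thesis using 3 by (simp add: rep_y)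
  qed (simp add: rep_y)
qed (simp_all add: rep_const rep_add rep_mult)

lemma hom_degree_ge:
  assumes "hom m p a" "p \<noteq> 0"
  shows "- m \<le> int (degree p)"
proof -
  have "poly p (- of_nat j) = 0" if "int j < - m" for j
  proof -
    \<comment> \<open>For \<open>j < - m\<close> the point \<open>w\<close> is a positive integer.
      Its indicator function therefore vanishes at all nonpositive integers, and the action of
      \<open>a\<close> on it returns the value of \<open>p\<close> at \<open>- j\<close>.\<close>
    define w where "w = - of_nat j - (of_int m :: 'k)"
    have "w \<noteq> - of_nat i" for i
    proof
      assume "w = - of_nat i"
      then have "of_int (- m + int i) = (of_int (int j) :: 'k)" by (simp add: w_def algebra_simps)
      then show False using that unfolding of_int_eq_iff by simp
    qed
    then have "\<rho> a (\<lambda>z. if z = w then 1 else 0) (- of_nat j) = 0"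
      by (intro rep_vanishing) auto
    then show ?thesis using assms by (simp add: hom_def w_def)
  qed
  \<comment> \<open>These are \<open>- m\<close> distinct roots of a nonzero polynomial.\<close>
  then have "(\<lambda>j. - of_nat j) ` {..<nat (- m)} \<subseteq> {z. poly p z = 0}" by auto
  then have "card ((\<lambda>j. - of_nat j :: 'k) ` {..<nat (- m)}) \<le> card {z. poly p z = 0}"
    using assms by (intro card_mono) (auto simp: poly_roots_finite)
  also have "\<dots> \<le> degree p" using assms by (intro card_poly_roots_bound)
  finally have "nat (- m) \<le> degree p"
    by (subst (asm) card_image) (auto simp: inj_on_def)
  then show ?thesis by simp
qed

end

section \<open>Subleading coefficients of translated polynomials\<close>

lemma coeff_mult_top:
  assumes "degree f \<le> i" "degree g \<le> j"
  shows "coeff (f * g) (i + j) = coeff f i * coeff g j"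
proof -
  have "coeff (f * g) (i + j) = (\<Sum>k\<in>{i}. coeff f k * coeff g (i + j - k))"
    unfolding coeff_mult
  proof (rule sum.mono_neutral_right)
    show "\<forall>k\<in>{..i + j} - {i}. coeff f k * coeff g (i + j - k) = 0"
    proof
      fix k assume k: "k \<in> {..i + j} - {i}"
      then consider "k > i" | "i + j - k > j" by fastforce
      then show "coeff f k * coeff g (i + j - k) = 0"
        using assms by cases (simp_all add: coeff_eq_0)
    qed
  qed auto
  then show ?thesis by simp
qed

text \<open>This is the Taylor expansion to first order. A bound on the degree, in place of its
  exact value, lets the induction pass from \<open>pCons a p\<close> to \<open>p\<close>.\<close>

lemma coeff_translate:
  fixes p :: "'k::field poly"
  assumes "degree p \<le> Suc k"
  shows "coeff (p \<circ>\<^sub>p [:- c, 1:]) (Suc k) = coeff p (Suc k) \<and>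
    coeff (p \<circ>\<^sub>p [:- c, 1:]) k = coeff p k - c * of_nat (Suc k) * coeff p (Suc k)"
  using assms
proof (induction p arbitrary: k)
  case (pCons a p)
  show ?case
  proof (cases k)
    case 0
    then have "degree p = 0" using pCons by (auto split: if_splits)
    then obtain b where "p = [:b:]" by (rule degree_eq_zeroE)
    then show ?thesis using 0 by (simp add: pcompose_pCons)
  next
    case (Suc l)
    then have deg: "degree p \<le> Suc l" using pCons by (auto split: if_splits)
    have "coeff (p \<circ>\<^sub>p [:- c, 1:]) (Suc (Suc l)) = 0"
      using deg by (intro coeff_eq_0) (simp add: degree_pcompose)
    moreover have "coeff p (Suc (Suc l)) = 0" using deg by (intro coeff_eq_0) simp
    ultimately show ?thesis using pCons(2)[OF deg] Suc
      by (simp add: pcompose_pCons coeff_pCons algebra_simps)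
  qed
qed simp

text \<open>Up to lower order the difference is \<open>- c\<close> times the derivative of
  \<open>p\<close>. For \<open>d = 0\<close> it is zero, so the truncated \<open>d - 1\<close> does
  no harm.\<close>

lemma translate_diff:
  fixes p :: "'k::field poly"
  assumes "degree p \<le> d"
  shows "degree (p \<circ>\<^sub>p [:- c, 1:] - p) \<le> d - 1 \<and>
    coeff (p \<circ>\<^sub>p [:- c, 1:] - p) (d - 1) = - (c * of_nat d * coeff p d)"
proof (cases d)
  case 0
  then obtain b where "p = [:b:]" using assms degree_eq_zeroE by blast
  then show ?thesis using 0 by simp
next
  case (Suc k)
  have *: "coeff (p \<circ>\<^sub>p [:- c, 1:] - p) (Suc k) = 0"
    "coeff (p \<circ>\<^sub>p [:- c, 1:] - p) k = - (c * of_nat d * coeff p d)"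
    using coeff_translate[of p k c] assms Suc by simp_all
  have "degree (p \<circ>\<^sub>p [:- c, 1:] - p) \<le> Suc k"
    using assms Suc by (intro degree_diff_le) (simp_all add: degree_pcompose)
  moreover have "degree (p \<circ>\<^sub>p [:- c, 1:] - p) \<noteq> Suc k"
    using * by (metis leading_coeff_0_iff degree_0 nat.distinct(1))
  ultimately show ?thesis using * Suc by simp
qed

text \<open>Here \<open>q\<close> is the coefficient of a commutator with \<open>u\<close>. The
  leading terms of its two products cancel, and the next coefficient is
  \<open>m * degree \<alpha> - n * degree p\<close> times both leading coefficients, which is
  nonzero in characteristic zero unless the two numbers balance.\<close>

lemma bracket_degree:
  fixes \<alpha> p :: "'k::field_char_0 poly" and n m :: int
  defines "q \<equiv> \<alpha> * (p \<circ>\<^sub>p [:- of_int n, 1:]) - p * (\<alpha> \<circ>\<^sub>p [:- of_int m, 1:])"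
  assumes \<alpha>: "degree \<alpha> > 0"
  shows "degree q \<le> degree p + degree \<alpha> - 1"
    and "n * int (degree p) \<noteq> m * int (degree \<alpha>) \<Longrightarrow> p \<noteq> 0 \<Longrightarrow>
      q \<noteq> 0 \<and> degree q = degree p + degree \<alpha> - 1"
proof -
  define P where "P = p \<circ>\<^sub>p [:- of_int n, 1:] - p"
  define Q where "Q = \<alpha> \<circ>\<^sub>p [:- of_int m, 1:] - \<alpha>"
  have q: "q = \<alpha> * P - p * Q" by (simp add: q_def P_def Q_def algebra_simps)
  have P: "degree P \<le> degree p - 1"
    "coeff P (degree p - 1) = - (of_int n * of_nat (degree p) * lead_coeff p)"
    unfolding P_def using translate_diff by blast+
  have Q: "degree Q \<le> degree \<alpha> - 1"
    "coeff Q (degree \<alpha> - 1) = - (of_int m * of_nat (degree \<alpha>) * lead_coeff \<alpha>)"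
    unfolding Q_def using translate_diff by blast+
  \<comment> \<open>Constant \<open>p\<close> is treated apart, because the truncated
    \<open>degree p - 1\<close> would spoil the index arithmetic below.\<close>
  have P0: "P = 0" if "degree p = 0"
    using that unfolding P_def by (metis degree_eq_zeroE diff_self pcompose_const)
  let ?s = "degree p + degree \<alpha> - 1"
  have \<alpha>P: "degree (\<alpha> * P) \<le> ?s"
    "coeff (\<alpha> * P) ?s = - (of_int n * of_nat (degree p) * lead_coeff p * lead_coeff \<alpha>)"
  proof (atomize (full), cases "degree p = 0")
    case False
    then have s: "?s = degree \<alpha> + (degree p - 1)" by simp
    have "degree (\<alpha> * P) \<le> degree \<alpha> + degree P" by (rule degree_mult_le)
    then show "degree (\<alpha> * P) \<le> ?s \<and>
        coeff (\<alpha> * P) ?s = - (of_int n * of_nat (degree p) * lead_coeff p * lead_coeff \<alpha>)"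
      unfolding s coeff_mult_top[OF order_refl P(1)] using P by simp
  qed (simp add: P0)
  have s: "?s = degree p + (degree \<alpha> - 1)" using \<alpha> by simp
  have "degree (p * Q) \<le> degree p + degree Q" by (rule degree_mult_le)
  then have pQ: "degree (p * Q) \<le> ?s"
    "coeff (p * Q) ?s = - (of_int m * of_nat (degree \<alpha>) * lead_coeff p * lead_coeff \<alpha>)"
    unfolding s coeff_mult_top[OF order_refl Q(1)] using Q by simp_all
  show le: "degree q \<le> ?s" unfolding q using \<alpha>P pQ by (intro degree_diff_le)
  assume ne: "n * int (degree p) \<noteq> m * int (degree \<alpha>)" "p \<noteq> 0"
  have "coeff q ?s = of_int (m * int (degree \<alpha>) - n * int (degree p)) * lead_coeff p * lead_coeff \<alpha>"
    unfolding q coeff_diff \<alpha>P pQ by (simp add: algebra_simps)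
  moreover have "of_int (m * int (degree \<alpha>) - n * int (degree p)) \<noteq> (0 :: 'k)"
    unfolding of_int_eq_0_iff using ne by simp
  moreover have "\<alpha> \<noteq> 0" using \<alpha> by auto
  ultimately have "coeff q ?s \<noteq> 0" using ne by simp
  then show "q \<noteq> 0 \<and> degree q = ?s" using le le_degree[of q ?s] by (auto intro: antisym)
qed

section \<open>Commutators with a homogeneous element\<close>

lemma nil_set_iff: "a \<in> nil_set u \<longleftrightarrow> (\<exists>k. (ad u ^^ k) a = 0)"
proof
  assume "\<exists>k. (ad u ^^ k) a = 0"
  then obtain k where "(ad u ^^ k) a = 0" by blast
  then have "(ad u ^^ Suc k) a = 0" by simp
  then show "a \<in> nil_set u" unfolding nil_set_eq_adker adker_def by blast
next
  assume "a \<in> nil_set u"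
  then show "\<exists>k. (ad u ^^ k) a = 0" unfolding nil_set_eq_adker adker_def by blast
qed

lemma nil_set_zero [simp]: "0 \<in> nil_set u"
  unfolding nil_set_iff by (intro exI[of _ 0]) simp

lemma nil_set_add:
  assumes "a \<in> nil_set u" "b \<in> nil_set u"
  shows "a + b \<in> nil_set u"
proof -
  obtain i j where "(ad u ^^ i) a = 0" "(ad u ^^ j) b = 0" using assms by (auto simp: nil_set_iff)
  then have "(ad u ^^ max i j) a = 0" "(ad u ^^ max i j) b = 0"
    by (auto intro: adpow_eq_zero_mono[of i] adpow_eq_zero_mono[of j])
  then have "(ad u ^^ max i j) (a + b) = 0" by (simp add: adpow_add)
  then show ?thesis unfolding nil_set_iff by blast
qed

lemma nil_set_mult:
  fixes u :: "'a::ring_1"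
  assumes "a \<in> nil_set u" "b \<in> nil_set u"
  shows "a * b \<in> nil_set u"
proof -
  obtain i j where "a \<in> adker u (Suc i)" "b \<in> adker u (Suc j)"
    using assms by (auto simp: nil_set_eq_adker)
  then show ?thesis unfolding nil_set_eq_adker using adker_mult by blast
qed

lemma nil_set_centralizer: "ad u a = 0 \<Longrightarrow> a \<in> nil_set u"
  unfolding nil_set_iff by (intro exI[of _ 1]) simp

lemma nil_set_const [simp]: "weyl_const c \<in> nil_set u"
  by (simp add: nil_set_centralizer)

lemma nil_set_one [simp]: "1 \<in> nil_set (u :: 'k::field weyl)"
  using nil_set_const[of 1 u] by simp

lemma nil_set_minus: "a \<in> nil_set u \<Longrightarrow> - a \<in> nil_set (u :: 'k::field weyl)"
  using nil_set_mult[OF nil_set_const, of a u "- 1"] by (simp add: weyl_const_minus)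

lemma nil_set_power: "a \<in> nil_set u \<Longrightarrow> a ^ n \<in> nil_set (u :: 'k::field weyl)"
  by (induction n) (simp_all add: nil_set_mult)

context weyl_rep
begin

lemma hom_ad:
  assumes "hom n \<alpha> u" "hom m p b"
  shows "hom (m + n) (\<alpha> * translate n p - p * translate m \<alpha>) (ad u b)"
  using hom_diff[OF hom_mult[OF assms] hom_mult[OF assms(2,1), unfolded add.commute[of m n]]]
  by (simp add: ad_def add.commute)

lemma hom_inj: "hom m p a \<Longrightarrow> hom m p b \<Longrightarrow> a = b"
  using hom_diff[of m p a p b] hom_eq_zero_iff[of m 0 "a - b"] by simp

lemma hom_0_eq_peval: "hom 0 p a \<Longrightarrow> a = peval p"
  using hom_inj hom_peval by blast

lemma comp_ad:
  assumes "u \<in> grade n"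
  shows "comp (ad u b) m = ad u (comp b (m - n))"
  by (simp add: ad_def comp_diff comp_grade_mult[OF assms])

lemma comp_adpow:
  assumes "u \<in> grade n"
  shows "comp ((ad u ^^ k) b) m = (ad u ^^ k) (comp b (m - int k * n))"
proof (induction k arbitrary: m)
  case (Suc k)
  show ?case by (simp add: comp_ad[OF assms] Suc algebra_simps)
qed simp

lemma adpow_grade:
  assumes "u \<in> grade n" "b \<in> grade m"
  shows "(ad u ^^ k) b \<in> grade (m + int k * n)"
  using comp_adpow[OF assms(1), of k b "m + int k * n"] comp_grade[OF assms(2)]
  by (metis add_diff_cancel_right' comp_in_grade)

text \<open>On degree \<open>m\<close> the commutator multiplies by \<open>p\<close> minus its
  translate by \<open>m\<close>. This is nonzero for \<open>m \<noteq> 0\<close>, so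
  \<open>ad u\<close> is injective away from degree zero, and it vanishes on degree zero.\<close>

lemma nil_set_degree_zero:
  assumes u: "hom 0 p u" "degree p > 0"
  shows "nil_set u = nil_filt u 0"
proof
  have gr: "u \<in> grade 0" using u by (auto simp: grade_def)
  have inj: "b = 0" if b: "b \<in> grade m" "ad u b = 0" "m \<noteq> 0" for b m
  proof (rule ccontr)
    assume "b \<noteq> 0"
    obtain q where q: "hom m q b" using b(1) by (auto simp: grade_def)
    have "hom m (p * q - q * translate m p) 0" using hom_ad[OF u(1) q] b(2) by simp
    then have "p * q - q * translate m p = 0" using hom_eq_zero_iff by blast
    moreover have "q \<noteq> 0" using q \<open>b \<noteq> 0\<close> hom_eq_zero_iff by blast
    ultimately have "translate m p - p = 0" by (simp add: mult.commute[of p q] flip: right_diff_distrib)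
    then have "of_int m * of_nat (degree p) * lead_coeff p = 0"
      using translate_diff[of p "degree p" "of_int m"] by simp
    then show False using b(3) u(2) by auto
  qed
  have inj_pow: "b = 0" if "b \<in> grade m" "(ad u ^^ k) b = 0" "m \<noteq> 0" for b m k
    using that
  proof (induction k)
    case (Suc k)
    have "(ad u ^^ k) b \<in> grade m" using adpow_grade[OF gr Suc(2), of k] by simp
    then have "(ad u ^^ k) b = 0" using inj Suc by simp
    then show ?case using Suc by simp
  qed simp
  show "nil_set u \<subseteq> nil_filt u 0"
  proof
    fix b assume "b \<in> nil_set u"
    then obtain k where k: "(ad u ^^ k) b = 0" by (auto simp: nil_set_iff)
    have "comp b m = 0" if "m \<noteq> 0" for m
    proof -
      have "(ad u ^^ k) (comp b m) = 0" using comp_adpow[OF gr, of k b m] k by simp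
      then show ?thesis using inj_pow that comp_in_grade by blast
    qed
    then have "{m. comp b m \<noteq> 0} \<subseteq> {0}" by auto
    then have "b = comp b 0" using sum_comp[of "{0}" b] by simp
    then have "b \<in> grade 0" by (metis comp_in_grade)
    then obtain q where "hom 0 q b" by (auto simp: grade_def)
    from hom_ad[OF u(1) this] have "ad u b = 0" using hom_eq_zero_iff[of 0 0] by (simp add: mult.commute)
    then show "b \<in> nil_filt u 0" by (simp add: nil_filt_def)
  qed
  show "nil_filt u 0 \<subseteq> nil_set u" by (auto simp: nil_set_def)
qed

text \<open>Such an element commutes with \<open>x\<close>, and its commutator with \<open>y\<close>
  again has a constant coefficient, hence commutes with \<open>u\<close>. So both generators lie in
  the subalgebra \<open>nil_set u\<close>.\<close>

lemma nil_set_constant_coefficient: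
  assumes u: "hom n [:c:] u"
  shows "nil_set u = UNIV"
proof -
  have "ad u x = 0"
    using hom_ad[OF u hom_x] hom_eq_zero_iff[of "1 + n" 0] by (simp add: one_pCons)
  then have x: "x \<in> nil_set u" by (rule nil_set_centralizer)
  have *: "ad u b = 0" if "hom m [:d:] b" for m d b
    using hom_ad[OF u that] hom_eq_zero_iff[of "m + n" 0] by (simp add: mult.commute)
  have "hom (- 1 + n) [:- (of_int n * c):] (ad u y)"
    using hom_ad[OF u hom_y] by (simp add: pcompose_pCons)
  then have "(ad u ^^ 2) y = 0" using * by (simp add: numeral_2_eq_2)
  then have y: "y \<in> nil_set u" by (auto simp: nil_set_iff)
  have "b \<in> nil_set u" for b
    by (induction b rule: generators_induct) (simp_all add: x y nil_set_add nil_set_mult)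
  then show ?thesis by auto
qed

end

locale nilpotent_homogeneous = weyl_rep +
  fixes u and n :: nat and \<alpha>
  assumes hom_u: "hom (int n) \<alpha> u" and n_pos: "n > 0" and degree_pos: "degree \<alpha> > 0"
begin

text \<open>The nilpotency degree of \<open>y ^ n\<close>, as \<open>val_y_power\<close>
  shows.\<close>

abbreviation slope :: nat where
  "slope \<equiv> degree \<alpha> + n"

lemma slope_eq: "int (n * (slope - 1)) = int n * (int (degree \<alpha>) + int n - 1)"
  using n_pos by (cases n) (simp_all add: algebra_simps)

lemma u_grade: "u \<in> grade (int n)"
  using hom_u by (auto simp: grade_def)

lemma u_nonzero: "u \<noteq> 0"
  using hom_eq_zero_iff[OF hom_u] degree_pos by auto

text \<open>The rational number \<open>degree p - m (degree \<alpha>) / n\<close> drops by at least one under each commutator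
  with \<open>u\<close>, and by exactly one unless it vanishes, so it counts the steps down to the centralizer.\<close>

lemma nilpotency_degree:
  assumes "hom m p b" "(ad u ^^ i) b \<noteq> 0" "(ad u ^^ Suc i) b = 0"
  shows "int n * int (degree p) = m * int (degree \<alpha>) + int n * int i"
  using assms
proof (induction i arbitrary: m p b)
  case 0
  let ?q = "\<alpha> * translate (int n) p - p * translate m \<alpha>"
  have "hom (m + int n) ?q 0" using hom_ad[OF hom_u 0(1)] 0(3) by simp
  then have "?q = 0" using hom_eq_zero_iff by blast
  moreover have "p \<noteq> 0" using 0 hom_eq_zero_iff by auto
  ultimately show ?case using bracket_degree(2)[OF degree_pos, of "int n" p m] by auto
next
  case (Suc i)
  let ?q = "\<alpha> * translate (int n) p - p * translate m \<alpha>"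
  have "hom (m + int n) ?q (ad u b)" by (rule hom_ad[OF hom_u Suc(2)])
  moreover have "(ad u ^^ i) (ad u b) \<noteq> 0" "(ad u ^^ Suc i) (ad u b) = 0"
    using Suc(3,4) by (simp_all add: funpow_swap1)
  ultimately have q: "int n * int (degree ?q) = (m + int n) * int (degree \<alpha>) + int n * int i"
    by (rule Suc(1))
  have "b \<noteq> 0" using Suc(3) by auto
  then have "p \<noteq> 0" using Suc(2) hom_eq_zero_iff by auto
  have eq: "int (degree p + degree \<alpha> - 1) = int (degree p) + int (degree \<alpha>) - 1"
    using degree_pos by simp
  show ?case
  proof (cases "int n * int (degree p) = m * int (degree \<alpha>)")
    case True
    \<comment> \<open>This case is impossible: the defect of \<open>b\<close> is already zero, so
      that of \<open>ad u b\<close> would be negative, against the induction hypothesis.\<close>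
    have "int (degree ?q) \<le> int (degree p) + int (degree \<alpha>) - 1"
      using bracket_degree(1)[OF degree_pos, of p "int n" m] eq by linarith
    then have "int n * int (degree ?q) \<le> int n * (int (degree p) + int (degree \<alpha>) - 1)"
      by (intro mult_left_mono) auto
    then have "int n + int i * int n \<le> 0" using q True by (simp add: algebra_simps)
    moreover have "0 \<le> int i * int n" "0 < int n" using n_pos by simp_all
    ultimately show ?thesis by linarith
  next
    case False
    then have "degree ?q = degree p + degree \<alpha> - 1"
      using bracket_degree(2)[OF degree_pos False \<open>p \<noteq> 0\<close>] by simp
    then have "int (degree ?q) = int (degree p) + int (degree \<alpha>) - 1" using eq by simp
    from arg_cong[OF this, of "\<lambda>t. int n * t"] q show ?thesis by (simp add: algebra_simps)
  qed
qed

section \<open>The centralizer\<close>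

lemma centralizer_degree:
  assumes "hom m p c" "ad u c = 0" "c \<noteq> 0"
  shows "int n * int (degree p) = m * int (degree \<alpha>)"
  using nilpotency_degree[of m p c 0] assms by simp

text \<open>Subtracting the multiple of \<open>d\<close> that cancels the leading coefficient leaves
  an element of the centralizer of the same degree. If it were nonzero, its coefficient would be
  forced to have the degree that was just cancelled.\<close>

lemma centralizer_grade_unique:
  assumes "c \<in> grade m" "d \<in> grade m" "ad u c = 0" "ad u d = 0" "d \<noteq> 0"
  shows "\<exists>k. c = weyl_const k * d"
proof (cases "c = 0")
  case True
  then show ?thesis by (intro exI[of _ 0]) simp
next
  case False
  obtain p q where pq: "hom m p c" "hom m q d" using assms(1,2) by (auto simp: grade_def)
  have q0: "q \<noteq> 0" using pq assms hom_eq_zero_iff by blast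
  define k where "k = lead_coeff p / lead_coeff q"
  have hom: "hom m (p - Polynomial.smult k q) (c - weyl_const k * d)"
    by (intro hom_diff hom_const_mult pq)
  have "int n * int (degree p) = int n * int (degree q)"
    using centralizer_degree[OF pq(1)] centralizer_degree[OF pq(2)] assms False by simp
  then have deg: "degree p = degree q" using n_pos by simp
  have "c - weyl_const k * d = 0"
  proof (rule ccontr)
    assume ne: "c - weyl_const k * d \<noteq> 0"
    moreover have "ad u (c - weyl_const k * d) = 0" using assms by (simp add: ad_diff ad_mult)
    ultimately have "int n * int (degree (p - Polynomial.smult k q)) = int n * int (degree p)"
      using centralizer_degree[OF hom] centralizer_degree[OF pq(1)] assms False by simp
    then have "degree (p - Polynomial.smult k q) = degree p" using n_pos by simp
    moreover have "coeff (p - Polynomial.smult k q) (degree p) = 0"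
      using q0 by (simp add: k_def deg)
    ultimately have "p - Polynomial.smult k q = 0" by (metis leading_coeff_0_iff)
    then show False using hom ne hom_eq_zero_iff by blast
  qed
  then show ?thesis by (intro exI[of _ k]) simp
qed

lemma lead_coeff_translate: "coeff (translate m p) (degree p) = lead_coeff p"
  using lead_coeff_comp[of "[:- of_int m, 1:]" p] by (simp add: degree_pcompose)

text \<open>The commutator of \<open>c\<close> and \<open>d\<close> centralizes \<open>u\<close> and
  has degree \<open>m + k\<close>. If it were nonzero, its coefficient would have degree
  \<open>degree p + degree q\<close>, but there the leading terms cancel.\<close>

lemma centralizer_grade_commute:
  assumes "c \<in> grade m" "d \<in> grade k" "ad u c = 0" "ad u d = 0"
  shows "c * d = d * c"
proof (cases "c = 0 \<or> d = 0")
  case False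
  obtain p q where pq: "hom m p c" "hom k q d" using assms(1,2) by (auto simp: grade_def)
  let ?r = "p * translate m q - q * translate k p"
  have hom: "hom (m + k) ?r (c * d - d * c)"
    using hom_diff[OF hom_mult[OF pq] hom_mult[OF pq(2,1), unfolded add.commute[of k m]]] .
  have "c * d - d * c = 0"
  proof (rule ccontr)
    assume ne: "c * d - d * c \<noteq> 0"
    moreover have "ad u (c * d - d * c) = 0" using assms by (simp add: ad_diff ad_mult)
    ultimately have "int n * int (degree ?r) = int n * (int (degree p) + int (degree q))"
      using centralizer_degree[OF hom] centralizer_degree[OF pq(1)] centralizer_degree[OF pq(2)]
        assms False by (simp add: algebra_simps)
    then have "degree ?r = degree p + degree q" using n_pos by simp
    moreover have "coeff (p * translate m q) (degree p + degree q) = lead_coeff p * lead_coeff q"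
      by (subst coeff_mult_top) (simp_all add: degree_pcompose lead_coeff_translate)
    moreover have "coeff (q * translate k p) (degree q + degree p) = lead_coeff q * lead_coeff p"
      by (subst coeff_mult_top) (simp_all add: degree_pcompose lead_coeff_translate)
    ultimately have "lead_coeff ?r = 0" by (simp add: add.commute mult.commute)
    then have "?r = 0" by (rule iffD1[OF leading_coeff_0_iff])
    then show False using hom ne hom_eq_zero_iff by blast
  qed
  then show ?thesis by simp
qed auto

lemma comp_centralizer: "ad u c = 0 \<Longrightarrow> ad u (comp c m) = 0"
  using comp_ad[OF u_grade, of c "m + int n"] by simp

lemma centralizer_commute:
  assumes "ad u c = 0" "ad u d = 0"
  shows "c * d = d * c"
proof -
  let ?S = "{m. comp c m \<noteq> 0}" and ?T = "{m. comp d m \<noteq> 0}"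
  have c: "c = (\<Sum>m\<in>?S. comp c m)" and d: "d = (\<Sum>m\<in>?T. comp d m)"
    using sum_comp[OF finite_comp subset_refl] by metis+
  have *: "comp c m * comp d k = comp d k * comp c m" for m k
    using centralizer_grade_commute[OF comp_in_grade comp_in_grade] comp_centralizer assms by blast
  have "(\<Sum>m\<in>?S. comp c m) * (\<Sum>m\<in>?T. comp d m) = (\<Sum>m\<in>?T. comp d m) * (\<Sum>m\<in>?S. comp c m)"
    unfolding sum_product by (subst sum.swap) (simp add: *)
  then show ?thesis using c d by simp
qed

section \<open>The valuation on the algebra of locally nilpotent elements\<close>

definition val :: "'a weyl \<Rightarrow> nat \<Rightarrow> int \<Rightarrow> bool" where
  "val b i m \<longleftrightarrow> (ad u ^^ Suc i) b = 0 \<and> top_degree ((ad u ^^ i) b) m"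

lemma const_nonzero: "(k :: 'a) \<noteq> 0 \<Longrightarrow> weyl_const k \<noteq> 0"
  using hom_eq_zero_iff[OF hom_const, of k] by simp

lemma top_degree_const_mult: "k \<noteq> 0 \<Longrightarrow> top_degree b m \<Longrightarrow> top_degree (weyl_const k * b) m"
  using mult_nonzero[OF const_nonzero, of k "comp b m"] by (simp add: top_degree_def comp_const_mult)

text \<open>The top iterated commutator of the product is a binomial multiple of the product of
  those of the factors. The binomial coefficient is nonzero in characteristic zero, and top degrees
  add.\<close>

lemma val_mult:
  assumes "val a i m" "val b j k"
  shows "val (a * b) (i + j) (m + k)"
proof -
  have z: "(ad u ^^ Suc i) a = 0" "(ad u ^^ Suc j) b = 0" using assms by (auto simp: val_def)
  have "top_degree ((ad u ^^ i) a * (ad u ^^ j) b) (m + k)"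
    using assms top_degree_mult by (auto simp: val_def)
  then have "top_degree ((ad u ^^ (i + j)) (a * b)) (m + k)"
    unfolding adpow_mult_top[OF z] weyl_const_of_nat[symmetric]
    by (intro top_degree_const_mult) simp_all
  then show ?thesis using adpow_mult_eq_zero[OF z] by (simp add: val_def)
qed

lemma val_one: "val 1 0 0"
proof -
  have "1 \<in> grade 0" using hom_one by (auto simp: grade_def)
  then show ?thesis using comp_grade[of 1 0] by (simp add: val_def top_degree_def ad_def)
qed

lemma val_power: "val a i m \<Longrightarrow> val (a ^ k) (k * i) (int k * m)"
proof (induction k)
  case (Suc k)
  then show ?case using val_mult[OF Suc(2) Suc(1)] by (simp add: distrib_right)
qed (simp add: val_one)

lemma val_exists:
  assumes "b \<in> nil_set u" "b \<noteq> 0"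
  shows "\<exists>i m. val b i m"
proof -
  obtain k where k: "(ad u ^^ k) b = 0" using assms nil_set_iff by blast
  define l where "l = (LEAST k. (ad u ^^ k) b = 0)"
  have l: "(ad u ^^ l) b = 0" unfolding l_def by (rule LeastI, rule k)
  then obtain i where i: "l = Suc i" using assms by (cases l) auto
  have "(ad u ^^ i) b \<noteq> 0"
    using not_less_Least[of i "\<lambda>k. (ad u ^^ k) b = 0"] i unfolding l_def by simp
  then show ?thesis using top_degree_exists l i unfolding val_def by blast
qed

text \<open>\<open>nilpotency_degree\<close> fixes the degree of the coefficient of one component of
  \<open>b\<close>, and \<open>hom_degree_ge\<close> bounds it from below. The result is a cone of
  values with the value of \<open>y ^ n\<close> on its boundary.\<close>

lemma val_bound:
  assumes "val b i m"
  shows "m * int slope \<ge> int (n * (slope - 1)) * int i"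
proof -
  \<comment> \<open>Each commutator with \<open>u\<close> raises the degree by \<open>n\<close>, so
    this is the component of \<open>b\<close> that arrives in degree \<open>m\<close>.\<close>
  define e where "e = comp b (m - int i * int n)"
  have e: "(ad u ^^ i) e \<noteq> 0" "(ad u ^^ Suc i) e = 0"
    using assms comp_adpow[OF u_grade, of i b m] comp_adpow[OF u_grade, of "Suc i" b "m + int n"]
    by (auto simp: e_def val_def top_degree_def algebra_simps simp del: funpow.simps)
  obtain p where p: "hom (m - int i * int n) p e"
    using comp_in_grade[of b "m - int i * int n"] by (auto simp: e_def grade_def)
  moreover have "e \<noteq> 0" using e by auto
  ultimately have "p \<noteq> 0" using hom_eq_zero_iff by blast
  then have "- (m - int i * int n) \<le> int (degree p)" using hom_degree_ge[OF p] by blast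
  then have "int n * (- (m - int i * int n)) \<le> int n * int (degree p)"
    by (intro mult_left_mono) auto
  moreover have "int n * int (degree p) = (m - int i * int n) * int (degree \<alpha>) + int n * int i"
    using nilpotency_degree[OF p e] .
  ultimately show ?thesis unfolding slope_eq by (simp add: algebra_simps)
qed

lemma val_nonneg:
  assumes "val b i m"
  shows "m \<ge> 0"
proof -
  have "0 \<le> int (n * (slope - 1)) * int i" by simp
  then have "0 \<le> m * int slope" using val_bound[OF assms] by linarith
  then show ?thesis using n_pos by (simp add: zero_le_mult_iff)
qed

text \<open>The leaves of the valuation are one-dimensional: the two leading components lie in the
  same degree of the centralizer, hence are proportional. Cancelling them lowers the value
  lexicographically.\<close>

lemma val_cancel:
  assumes "val a i m" "val b i m"
  obtains k where "a = weyl_const k * b" |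
    k j l where "val (a - weyl_const k * b) j l" "j < i \<or> j = i \<and> l < m"
proof -
  let ?a = "(ad u ^^ i) a" and ?b = "(ad u ^^ i) b"
  have "ad u ?a = 0" "ad u ?b = 0" using assms by (simp_all add: val_def)
  then have "ad u (comp ?a m) = 0" "ad u (comp ?b m) = 0" using comp_centralizer by blast+
  moreover have "comp ?b m \<noteq> 0" using assms by (simp add: val_def top_degree_def)
  ultimately obtain k where k: "comp ?a m = weyl_const k * comp ?b m"
    using centralizer_grade_unique[OF comp_in_grade comp_in_grade] by blast
  define d where "d = a - weyl_const k * b"
  have pow: "(ad u ^^ j) d = (ad u ^^ j) a - weyl_const k * (ad u ^^ j) b" for j
    by (simp add: d_def adpow_diff adpow_weyl_const_mult)
  have d0: "(ad u ^^ Suc i) d = 0" unfolding pow using assms by (simp add: val_def)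
  have below: "comp ((ad u ^^ i) d) l = 0" if "l \<ge> m" for l
    using assms that k unfolding pow
    by (cases "l = m") (auto simp: val_def top_degree_def comp_diff comp_const_mult)
  show thesis
  proof (cases "d = 0")
    case True
    then show ?thesis using that(1) by (simp add: d_def)
  next
    case False
    have "d \<in> nil_set u" using d0 nil_set_iff by blast
    then obtain j l where jl: "val d j l" using val_exists False by blast
    have "(ad u ^^ j) d \<noteq> 0" using jl top_degree_nonzero by (auto simp: val_def)
    then have "j \<le> i" using adpow_eq_zero_mono[OF d0, of j] by (metis not_less_eq_eq)
    moreover have "l < m" if "j = i"
      using jl below that by (auto simp: val_def top_degree_def intro: leI ccontr)
    ultimately show ?thesis using that(2) jl unfolding d_def by fastforce
  qed
qed

section \<open>Values of the distinguished elements\<close>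

lemma val_u: "val u 0 (int n)"
  using comp_grade[OF u_grade] u_nonzero by (simp add: val_def top_degree_def ad_def)

lemma val_grade:
  assumes "e \<in> grade m" "(ad u ^^ i) e \<noteq> 0" "(ad u ^^ Suc i) e = 0"
  shows "val e i (m + int i * int n)"
  using assms comp_grade[OF adpow_grade[OF u_grade assms(1), of i]]
  by (simp add: val_def top_degree_def)

text \<open>The commutator of \<open>u\<close> with \<open>h\<close> is \<open>- n\<close> times
  \<open>u\<close>, so two applications of \<open>ad u\<close> kill \<open>h\<close>.\<close>

lemma peval_nil: "peval p \<in> nil_set u"
proof -
  have "hom (int n) (\<alpha> * [:- of_int (int n), 1:] - [:0, 1:] * \<alpha>) (ad u h)"
    using hom_ad[OF hom_u hom_h] by (simp add: pcompose_pCons)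
  moreover have "\<alpha> * [:- of_int (int n), 1:] - [:0, 1:] * \<alpha> = Polynomial.smult (- of_nat n) \<alpha>"
    by simp
  ultimately have "hom (int n) (Polynomial.smult (- of_nat n) \<alpha>) (ad u h)" by metis
  then have "ad u h = weyl_const (- of_nat n) * u"
    using hom_inj hom_const_mult[OF hom_u] by blast
  moreover have "ad u (weyl_const (- of_nat n) * u) = 0"
    by (simp add: ad_mult) (simp add: ad_def)
  ultimately have "(ad u ^^ 2) h = 0" by (simp add: numeral_2_eq_2)
  then have "h \<in> nil_set u" by (auto simp: nil_set_iff)
  then show ?thesis by (induction p) (simp_all add: nil_set_add nil_set_mult)
qed

text \<open>The product \<open>u * y ^ n\<close> has degree zero, so it is a polynomial in
  \<open>h\<close>, of degree \<open>slope\<close>. The degree formula gives its nilpotency degree,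
  and \<open>u\<close> can be cancelled since it commutes with itself and is no zero
  divisor.\<close>

lemma val_y_power: "val (y ^ n) slope (int (n * (slope - 1)))"
proof -
  obtain q where q: "q \<noteq> 0" "degree q = n" "hom (- int n) q (y ^ n)" using hom_y_power by blast
  define g where "g = \<alpha> * translate (int n) q"
  have hom: "hom 0 g (u * y ^ n)" using hom_mult[OF hom_u q(3)] by (simp add: g_def)
  have "\<alpha> \<noteq> 0" using degree_pos by auto
  then have deg: "degree g = slope"
    using q by (simp add: g_def degree_mult_eq pcompose_eq_0_iff degree_pcompose)
  have "u * y ^ n \<in> nil_set u" using hom_0_eq_peval[OF hom] peval_nil by simp
  moreover have "y ^ n \<noteq> 0" using q hom_eq_zero_iff by blast
  then have "u * y ^ n \<noteq> 0" using u_nonzero mult_nonzero by blast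
  ultimately obtain i m where im: "val (u * y ^ n) i m" using val_exists by blast
  then have i: "(ad u ^^ i) (u * y ^ n) \<noteq> 0" "(ad u ^^ Suc i) (u * y ^ n) = 0"
    using top_degree_nonzero by (auto simp: val_def)
  have "int n * int slope = int n * int i" using nilpotency_degree[OF hom i] deg by simp
  then have "i = slope" using n_pos by simp
  moreover have "(ad u ^^ k) (u * y ^ n) = u * (ad u ^^ k) (y ^ n)" for k
    by (rule adpow_mult_commuting) (simp add: ad_def)
  ultimately have "(ad u ^^ slope) (y ^ n) \<noteq> 0" "u * (ad u ^^ Suc slope) (y ^ n) = 0"
    using i by (auto simp del: funpow.simps)
  then have "val (y ^ n) slope (- int n + int slope * int n)"
    using q(3) u_nonzero mult_nonzero by (intro val_grade) (auto simp: grade_def)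
  moreover have "- int n + int slope * int n = int (n * (slope - 1))"
    unfolding slope_eq by (simp add: algebra_simps)
  ultimately show ?thesis by simp
qed

end

section \<open>Finitely generated exponent sets\<close>

text \<open>A point \<open>(a, b)\<close> of least second coordinate lies below every point whose
  first coordinate is at least \<open>a\<close>. Each of the finitely many columns left of
  \<open>a\<close> contributes its lowest point.\<close>

lemma dickson_pairs:
  fixes T :: "(nat \<times> nat) set"
  shows "\<exists>F. finite F \<and> F \<subseteq> T \<and> (\<forall>t\<in>T. \<exists>f\<in>F. fst f \<le> fst t \<and> snd f \<le> snd t)"
proof (cases "T = {}")
  case False
  define b where "b = (LEAST b. \<exists>a. (a, b) \<in> T)"
  have "\<exists>b a. (a, b) \<in> T" using False by auto
  then have "\<exists>a. (a, b) \<in> T" unfolding b_def by (rule LeastI_ex)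
  then obtain a where a: "(a, b) \<in> T" by blast
  have b_le: "b \<le> d" if "(c, d) \<in> T" for c d
    unfolding b_def using that by (intro Least_le) blast
  define g where "g c = (c, LEAST d. (c, d) \<in> T)" for c
  define C where "C = {c. c < a \<and> (\<exists>d. (c, d) \<in> T)}"
  have g: "g c \<in> T" if "c \<in> C" for c
    using that unfolding C_def g_def by (auto intro: LeastI)
  have "\<exists>f\<in>insert (a, b) (g ` C). fst f \<le> c \<and> snd f \<le> d" if t: "(c, d) \<in> T" for c d
  proof (cases "a \<le> c")
    case True
    then show ?thesis using b_le t by auto
  next
    case False
    then have "c \<in> C" using t by (auto simp: C_def)
    moreover have "snd (g c) \<le> d" using t by (simp add: g_def Least_le)
    ultimately show ?thesis by (auto simp: g_def)
  qed
  moreover have "finite (insert (a, b) (g ` C))" by (simp add: C_def)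
  moreover have "insert (a, b) (g ` C) \<subseteq> T" using a g by blast
  ultimately show ?thesis by (intro exI[of _ "insert (a, b) (g ` C)"]) auto
qed auto

text \<open>Division with remainder puts each point of the cone spanned by \<open>(0, n)\<close> and \<open>(A, B)\<close> into one of
  finitely many translates of the free monoid on these two vectors.\<close>

lemma cone_finitely_generated:
  fixes S :: "(nat \<times> nat) set" and A B n :: nat
  assumes "A > 0" "n > 0" and S: "\<And>i m. (i, m) \<in> S \<Longrightarrow> B * i \<le> m * A"
  shows "\<exists>F. finite F \<and> F \<subseteq> S \<and>
    (\<forall>(i, m)\<in>S. \<exists>(j, k)\<in>F. \<exists>p q. i = j + q * A \<and> m = k + p * n + q * B)"
proof -
  define pt where "pt r = (\<lambda>(p, q). (fst r + q * A, snd r + p * n + q * B))" for r :: "nat \<times> nat"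
  define T where "T r = {t. pt r t \<in> S}" for r
  define R where "R = {..<A} \<times> {..<n}"
  \<comment> \<open>For each base point \<open>r\<close>, Dickson's lemma applies to the exponent
    pairs \<open>(p, q)\<close> of the points of \<open>S\<close>.\<close>
  have "\<forall>r. \<exists>F. finite F \<and> F \<subseteq> T r \<and> (\<forall>t\<in>T r. \<exists>f\<in>F. fst f \<le> fst t \<and> snd f \<le> snd t)"
    using dickson_pairs by blast
  then obtain F where F: "\<And>r. finite (F r)" "\<And>r. F r \<subseteq> T r"
    "\<And>r t. t \<in> T r \<Longrightarrow> \<exists>f\<in>F r. fst f \<le> fst t \<and> snd f \<le> snd t"
    by metis
  define G where "G = (\<Union>r\<in>R. pt r ` F r)"
  have "finite G" using F(1) by (simp add: G_def R_def)
  moreover have "G \<subseteq> S" using F(2) by (fastforce simp: G_def T_def)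
  moreover have "\<exists>(j, k)\<in>G. \<exists>p q. i = j + q * A \<and> m = k + p * n + q * B" if im: "(i, m) \<in> S" for i m
  proof -
    define q where "q = i div A"
    \<comment> \<open>The cone condition gives \<open>q * B \<le> m\<close>, so the natural
      subtraction in \<open>m - q * B\<close> is exact.\<close>
    have "B * q * A \<le> B * i" unfolding q_def by (simp add: mult.assoc)
    then have "B * q * A \<le> m * A" using S[OF im] by linarith
    then have qm: "q * B \<le> m" using assms(1) by (simp add: mult.commute)
    define p where "p = (m - q * B) div n"
    define r where "r = (i mod A, (m - q * B) mod n)"
    have "pt r (p, q) = (i, m)"
      using qm by (simp add: pt_def r_def p_def q_def algebra_simps)
    then have "(p, q) \<in> T r" using im by (simp add: T_def)
    then obtain p' q' where f: "(p', q') \<in> F r" "p' \<le> p" "q' \<le> q" using F(3) by fastforce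
    have "r \<in> R" using assms by (simp add: r_def R_def)
    then have "pt r (p', q') \<in> G" using f by (auto simp: G_def)
    moreover have "p = p' + (p - p')" "q = q' + (q - q')" using f by simp_all
    then have "i = fst (pt r (p', q')) + (q - q') * A"
      "m = snd (pt r (p', q')) + (p - p') * n + (q - q') * B"
      using \<open>pt r (p, q) = (i, m)\<close> unfolding pt_def
      by (auto simp: add.assoc) (metis add.assoc add.commute distrib_right)+
    ultimately show ?thesis by (metis (mono_tags, lifting) case_prod_beta)
  qed
  ultimately show ?thesis by (intro exI[of _ G]) auto
qed

text \<open>Adding one scalar multiple at a time matches the successive cancellation of leading
  terms.\<close>

inductive_set lin_span :: "'k::field weyl set \<Rightarrow> 'k weyl set" for B where
  zero: "0 \<in> lin_span B"
| step: "b \<in> B \<Longrightarrow> a \<in> lin_span B \<Longrightarrow> weyl_const c * b + a \<in> lin_span B"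

section \<open>Standard bases\<close>

context nilpotent_homogeneous
begin

abbreviation w where "w \<equiv> y ^ n"

lemma u_nil: "u \<in> nil_set u"
  by (rule nil_set_centralizer) (simp add: ad_def)

lemma w_nil: "w \<in> nil_set u"
  using val_y_power unfolding nil_set_iff val_def by blast

text \<open>\<open>E\<close> realizes generators of the value set of \<open>V\<close>, and
  multiplication by \<open>u\<close> and \<open>w\<close> translates values along the two generating
  vectors. The three orders of the factors serve left ideals, right ideals and splitting off
  \<open>u\<close> on either side.\<close>

lemma standard_basis:
  assumes "V \<subseteq> nil_set u"
  obtains E where "finite E" "E \<subseteq> V" "\<And>e. e \<in> E \<Longrightarrow> \<exists>i m. val e i m"
    "\<And>a i m. a \<in> V \<Longrightarrow> val a i m \<Longrightarrow>
      \<exists>e\<in>E. \<exists>p q. val (u ^ p * w ^ q * e) i m \<and> val (e * w ^ q * u ^ p) i m \<and>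
        val (u ^ p * (e * w ^ q)) i m"
proof -
  define S where "S = {(i, m). \<exists>a\<in>V. val a i (int m)}"
  have "n * (slope - 1) * i \<le> m * slope" if im: "(i, m) \<in> S" for i m
  proof -
    obtain a where "val a i (int m)" using im by (auto simp: S_def)
    from val_bound[OF this] have "int (n * (slope - 1) * i) \<le> int (m * slope)" by simp
    then show ?thesis by (simp only: of_nat_le_iff)
  qed
  then obtain F where F: "finite F" "F \<subseteq> S" "\<forall>(i, m)\<in>S. \<exists>(j, k)\<in>F. \<exists>p q.
      i = j + q * slope \<and> m = k + p * n + q * (n * (slope - 1))"
    using cone_finitely_generated[of slope n S "n * (slope - 1)"] n_pos by auto
  have "\<forall>f. \<exists>e. f \<in> F \<longrightarrow> e \<in> V \<and> val e (fst f) (int (snd f))"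
    using F(2) by (fastforce simp: S_def)
  then obtain e where e: "\<And>f. f \<in> F \<Longrightarrow> e f \<in> V \<and> val (e f) (fst f) (int (snd f))" by metis
  show thesis
  proof (rule that[of "e ` F"])
    fix a i m assume a: "a \<in> V" "val a i m"
    then obtain m' where m': "m = int m'" using val_nonneg zero_le_imp_eq_int by blast
    then have "(i, m') \<in> S" using a by (auto simp: S_def)
    then obtain j k p q where f: "(j, k) \<in> F" "i = j + q * slope"
      "m' = k + p * n + q * (n * (slope - 1))"
      using F(3) by fastforce
    have E: "val (e (j, k)) j (int k)" using e[OF f(1)] by simp
    have U: "val (u ^ p) 0 (int p * int n)" using val_power[OF val_u, of p] by simp
    have W: "val (w ^ q) (q * slope) (int q * int (n * (slope - 1)))" by (rule val_power[OF val_y_power])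
    have i: "0 + q * slope + j = i" "j + q * slope + 0 = i" "0 + (j + q * slope) = i"
      using f by simp_all
    have m: "int p * int n + int q * int (n * (slope - 1)) + int k = m"
      "int k + int q * int (n * (slope - 1)) + int p * int n = m"
      "int p * int n + (int k + int q * int (n * (slope - 1))) = m"
      using f m' by simp_all
    have "val (u ^ p * w ^ q * e (j, k)) i m" "val (e (j, k) * w ^ q * u ^ p) i m"
      "val (u ^ p * (e (j, k) * w ^ q)) i m"
      using val_mult[OF val_mult[OF U W] E] val_mult[OF val_mult[OF E W] U]
        val_mult[OF U val_mult[OF E W]] unfolding i m by blast+
    then show "\<exists>e\<in>e ` F. \<exists>p q. val (u ^ p * w ^ q * e) i m \<and> val (e * w ^ q * u ^ p) i m \<and>
        val (u ^ p * (e * w ^ q)) i m"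
      using f(1) by blast
  next
    fix e' assume "e' \<in> e ` F"
    then show "\<exists>i m. val e' i m" using e by blast
  qed (use F e in auto)
qed

text \<open>Subtracting a multiple of the element of \<open>B\<close> with the same value gives zero
  or lowers the value in the lexicographic order on pairs of natural numbers, which is
  well-founded.\<close>

lemma spanning:
  assumes "V \<subseteq> nil_set u" "B \<subseteq> V"
    and diff: "\<And>a b c. a \<in> V \<Longrightarrow> b \<in> V \<Longrightarrow> a - weyl_const c * b \<in> V"
    and vals: "\<And>a i m. a \<in> V \<Longrightarrow> val a i m \<Longrightarrow> \<exists>b\<in>B. val b i m"
    and "a \<in> V"
  shows "a \<in> lin_span B"
proof (cases "a = 0")
  case False
  have "a \<in> lin_span B" if "a \<in> V" "val a i m" "t = (i, nat m)" for t a i m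
    using that
  proof (induction t arbitrary: a i m rule: wf_induct_rule[OF wf_lex_prod[OF wf_less_than wf_less_than]])
    case (1 t)
    obtain b where b: "b \<in> B" "val b i m" using vals 1 by blast
    from 1(3) b(2) show ?case
    proof (rule val_cancel)
      fix k assume "a = weyl_const k * b"
      then show ?thesis using lin_span.step[OF b(1) lin_span.zero, of k] by simp
    next
      fix k j l assume jl: "val (a - weyl_const k * b) j l" "j < i \<or> j = i \<and> l < m"
      have "((j, nat l), t) \<in> less_than <*lex*> less_than"
        using jl(2) val_nonneg[OF jl(1)] 1(4) by auto
      moreover have "a - weyl_const k * b \<in> V" using diff 1(2) b assms(2) by blast
      ultimately have "a - weyl_const k * b \<in> lin_span B" using 1(1) jl(1) by blast
      from lin_span.step[OF b(1) this, of k] show ?thesis by simp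
    qed
  qed
  then show ?thesis using val_exists assms(1,5) False by blast
qed (simp add: lin_span.zero)

lemma lin_span_subset:
  assumes "a \<in> lin_span B" "0 \<in> V" "\<And>a b c. b \<in> B \<Longrightarrow> a \<in> V \<Longrightarrow> weyl_const c * b + a \<in> V"
  shows "a \<in> V"
  using assms(1) by induction (use assms in auto)

lemma monomial_nil:
  assumes "E \<subseteq> nil_set u" "e \<in> E"
  shows "u ^ p * w ^ q * e \<in> nil_set u" "e * w ^ q * u ^ p \<in> nil_set u" "u ^ p * (e * w ^ q) \<in> nil_set u"
proof -
  have "u ^ p \<in> nil_set u" "w ^ q \<in> nil_set u" using u_nil w_nil nil_set_power by blast+
  then show "u ^ p * w ^ q * e \<in> nil_set u" "e * w ^ q * u ^ p \<in> nil_set u"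
    "u ^ p * (e * w ^ q) \<in> nil_set u"
    using assms nil_set_mult by blast+
qed

lemma nil_set_diff_const: "a \<in> nil_set u \<Longrightarrow> b \<in> nil_set u \<Longrightarrow> a - weyl_const c * b \<in> nil_set u"
  using nil_set_add nil_set_minus nil_set_mult nil_set_const by (metis add_uminus_conv_diff)

end

section \<open>The algebra of locally nilpotent elements\<close>

lemma nil_algebra_simps [simp]:
  "carrier (nil_algebra u) = nil_set u"
  "a \<otimes>\<^bsub>nil_algebra u\<^esub> b = a * b" "a \<oplus>\<^bsub>nil_algebra u\<^esub> b = a + b"
  "\<one>\<^bsub>nil_algebra u\<^esub> = 1" "\<zero>\<^bsub>nil_algebra u\<^esub> = 0" "c \<odot>\<^bsub>nil_algebra u\<^esub> a = weyl_const c * a"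
  by (simp_all add: nil_algebra_def weyl_algebra_def)

lemma nil_ring: "ring (nil_algebra u)"
proof (rule ringI)
  show "abelian_group (nil_algebra u)"
  proof (rule abelian_groupI)
    fix a assume "a \<in> carrier (nil_algebra u)"
    then show "\<exists>b\<in>carrier (nil_algebra u). b \<oplus>\<^bsub>nil_algebra u\<^esub> a = \<zero>\<^bsub>nil_algebra u\<^esub>"
      by (intro bexI[of _ "- a"]) (simp_all add: nil_set_minus)
  qed (simp_all add: nil_set_add add_ac)
  show "Group.monoid (nil_algebra u)"
    by (rule monoidI) (simp_all add: nil_set_mult mult.assoc)
qed (simp_all add: distrib_left distrib_right)

lemma nil_assoc_algebra: "assoc_algebra base_field (nil_algebra u)"
proof (rule assoc_algebraI)
  interpret ring "nil_algebra u" by (rule nil_ring)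
  show "ring (nil_algebra u)" by (rule nil_ring)
  show "module base_field (nil_algebra u)"
    by (rule moduleI)
      (simp_all add: cring_from_type_algebra is_abelian_group nil_set_mult weyl_const_add
        weyl_const_mult distrib_left distrib_right mult.assoc)
  fix c a b
  show "(c \<odot>\<^bsub>nil_algebra u\<^esub> a) \<otimes>\<^bsub>nil_algebra u\<^esub> b = c \<odot>\<^bsub>nil_algebra u\<^esub> (a \<otimes>\<^bsub>nil_algebra u\<^esub> b)"
    by (simp add: mult.assoc)
  show "a \<otimes>\<^bsub>nil_algebra u\<^esub> (c \<odot>\<^bsub>nil_algebra u\<^esub> b) = c \<odot>\<^bsub>nil_algebra u\<^esub> (a \<otimes>\<^bsub>nil_algebra u\<^esub> b)"
    by simp (metis mult.assoc weyl_const_commute)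
qed

lemma left_idealD:
  assumes "left_ideal I (nil_algebra u)"
  shows "I \<subseteq> nil_set u" "0 \<in> I" "\<And>a b. a \<in> I \<Longrightarrow> b \<in> I \<Longrightarrow> a + b \<in> I"
    "\<And>r a. r \<in> nil_set u \<Longrightarrow> a \<in> I \<Longrightarrow> r * a \<in> I"
proof -
  interpret additive_subgroup I "nil_algebra u" using assms by (simp add: left_ideal_def)
  show "I \<subseteq> nil_set u" "0 \<in> I" "\<And>a b. a \<in> I \<Longrightarrow> b \<in> I \<Longrightarrow> a + b \<in> I"
    using a_subset zero_closed a_closed by simp_all
  show "\<And>r a. r \<in> nil_set u \<Longrightarrow> a \<in> I \<Longrightarrow> r * a \<in> I" using assms by (simp add: left_ideal_def)
qed

lemma right_idealD:
  assumes "right_ideal I (nil_algebra u)"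
  shows "I \<subseteq> nil_set u" "0 \<in> I" "\<And>a b. a \<in> I \<Longrightarrow> b \<in> I \<Longrightarrow> a + b \<in> I"
    "\<And>r a. r \<in> nil_set u \<Longrightarrow> a \<in> I \<Longrightarrow> a * r \<in> I"
proof -
  interpret additive_subgroup I "nil_algebra u" using assms by (simp add: right_ideal_def)
  show "I \<subseteq> nil_set u" "0 \<in> I" "\<And>a b. a \<in> I \<Longrightarrow> b \<in> I \<Longrightarrow> a + b \<in> I"
    using a_subset zero_closed a_closed by simp_all
  show "\<And>r a. r \<in> nil_set u \<Longrightarrow> a \<in> I \<Longrightarrow> a * r \<in> I" using assms by (simp add: right_ideal_def)
qed

context nilpotent_homogeneous
begin

text \<open>Monomial multiples of a standard basis \<open>E\<close> of \<open>I\<close> span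
  \<open>I\<close> linearly. They lie in every one-sided ideal of the same kind containing
  \<open>E\<close>, so \<open>E\<close> generates \<open>I\<close>.\<close>

lemma nil_noetherian: "noetherian (nil_algebra u)"
proof -
  have "\<exists>S. finite S \<and> S \<subseteq> I \<and> I = \<Inter>{J. left_ideal J (nil_algebra u) \<and> S \<subseteq> J}"
    if I: "left_ideal I (nil_algebra u)" for I
  proof -
    note ID = left_idealD[OF I]
    obtain E where E: "finite E" "E \<subseteq> I" "\<And>a i m. a \<in> I \<Longrightarrow> val a i m \<Longrightarrow>
        \<exists>e\<in>E. \<exists>p q. val (u ^ p * w ^ q * e) i m"
      using standard_basis[OF ID(1)] by metis
    define B where "B = {u ^ p * w ^ q * e |p q e. e \<in> E}"
    have B: "B \<subseteq> J" if J: "left_ideal J (nil_algebra u)" "E \<subseteq> J" for J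
    proof -
      have "u ^ p * w ^ q \<in> nil_set u" for p q
        using u_nil w_nil nil_set_power nil_set_mult by metis
      then show ?thesis using left_idealD(4)[OF J(1)] J(2) by (auto simp: B_def)
    qed
    have span: "a \<in> lin_span B" if "a \<in> I" for a
    proof (rule spanning[OF ID(1) B[OF I E(2)] _ _ that])
      fix a b c assume "a \<in> I" "b \<in> I"
      then have "a + weyl_const (- c) * b \<in> I" using ID by simp
      then show "a - weyl_const c * b \<in> I" by (simp add: weyl_const_minus)
    next
      fix a i m assume "a \<in> I" "val a i m"
      from E(3)[OF this] show "\<exists>b\<in>B. val b i m" unfolding B_def by blast
    qed
    have "I \<subseteq> J" if J: "left_ideal J (nil_algebra u)" "E \<subseteq> J" for J
    proof
      fix a assume "a \<in> I"
      from span[OF this] show "a \<in> J"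
        by (rule lin_span_subset) (use left_idealD[OF J(1)] B[OF J] in auto)
    qed
    then have "I = \<Inter>{J. left_ideal J (nil_algebra u) \<and> E \<subseteq> J}" using I E(2) by blast
    then show ?thesis using E by blast
  qed
  moreover have "\<exists>S. finite S \<and> S \<subseteq> I \<and> I = \<Inter>{J. right_ideal J (nil_algebra u) \<and> S \<subseteq> J}"
    if I: "right_ideal I (nil_algebra u)" for I
  proof -
    note ID = right_idealD[OF I]
    obtain E where E: "finite E" "E \<subseteq> I" "\<And>a i m. a \<in> I \<Longrightarrow> val a i m \<Longrightarrow>
        \<exists>e\<in>E. \<exists>p q. val (e * w ^ q * u ^ p) i m"
      using standard_basis[OF ID(1)] by metis
    define B where "B = {e * w ^ q * u ^ p |p q e. e \<in> E}"
    have B: "B \<subseteq> J" if J: "right_ideal J (nil_algebra u)" "E \<subseteq> J" for J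
    proof -
      have "w ^ q * u ^ p \<in> nil_set u" for p q
        using u_nil w_nil nil_set_power nil_set_mult by metis
      then show ?thesis using right_idealD(4)[OF J(1)] J(2) by (auto simp: B_def mult.assoc)
    qed
    have const: "weyl_const c * b \<in> J" if "right_ideal J (nil_algebra u)" "b \<in> J" for J b c
      using right_idealD(4)[OF that(1) nil_set_const that(2), of c] by (simp add: weyl_const_commute)
    have span: "a \<in> lin_span B" if "a \<in> I" for a
    proof (rule spanning[OF ID(1) B[OF I E(2)] _ _ that])
      fix a b c assume "a \<in> I" "b \<in> I"
      then have "a + weyl_const (- c) * b \<in> I" using ID const[OF I] by simp
      then show "a - weyl_const c * b \<in> I" by (simp add: weyl_const_minus)
    next
      fix a i m assume "a \<in> I" "val a i m"
      from E(3)[OF this] show "\<exists>b\<in>B. val b i m" unfolding B_def by blast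
    qed
    have "I \<subseteq> J" if J: "right_ideal J (nil_algebra u)" "E \<subseteq> J" for J
    proof
      fix a assume "a \<in> I"
      from span[OF this] show "a \<in> J"
        by (rule lin_span_subset) (use right_idealD[OF J(1)] const[OF J(1)] B[OF J] in auto)
    qed
    then have "I = \<Inter>{J. right_ideal J (nil_algebra u) \<and> E \<subseteq> J}" using I E(2) by blast
    then show ?thesis using E by blast
  qed
  ultimately show ?thesis unfolding noetherian_def using nil_ring by blast
qed

text \<open>The standard monomials of the whole algebra are products of \<open>u\<close>,
  \<open>w\<close> and finitely many further elements.\<close>

lemma nil_affine: "affine_algebra base_field (nil_algebra u)"
proof -
  obtain E where E: "finite E" "E \<subseteq> nil_set u" "\<And>a i m. a \<in> nil_set u \<Longrightarrow> val a i m \<Longrightarrow>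
      \<exists>e\<in>E. \<exists>p q. val (u ^ p * w ^ q * e) i m"
    using standard_basis[OF subset_refl] by metis
  define B where "B = {u ^ p * w ^ q * e |p q e. e \<in> E}"
  define S where "S = insert u (insert w E)"
  let ?gen = "algebra_generate base_field (nil_algebra u) S"
  have S: "finite S" "S \<subseteq> nil_set u" using E u_nil w_nil by (auto simp: S_def)
  have mult: "a * b \<in> ?gen" if "a \<in> ?gen" "b \<in> ?gen" for a b
    using algebra_generate.mult[OF that] by simp
  have add: "a + b \<in> ?gen" if "a \<in> ?gen" "b \<in> ?gen" for a b
    using algebra_generate.add[OF that] by simp
  have smult: "weyl_const c * a \<in> ?gen" if "a \<in> ?gen" for c a
    using algebra_generate.smult[OF _ that, of c] by simp
  have "\<one>\<^bsub>nil_algebra u\<^esub> \<in> ?gen" by (rule algebra_generate.one)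
  then have one: "1 \<in> ?gen" by simp
  have power: "a ^ p \<in> ?gen" if "a \<in> ?gen" for a p
    by (induction p) (simp_all add: mult one that)
  have gens: "a \<in> ?gen" if "a \<in> S" for a using that by (rule algebra_generate.incl)
  have B: "B \<subseteq> ?gen"
  proof
    fix b assume "b \<in> B"
    then obtain p q e where b: "b = u ^ p * w ^ q * e" and e: "e \<in> E" by (auto simp: B_def)
    show "b \<in> ?gen" unfolding b by (intro mult power[of u] power[of w] gens) (simp_all add: S_def e)
  qed
  have "a \<in> ?gen" if "a \<in> nil_set u" for a
  proof -
    have "a \<in> lin_span B"
    proof (rule spanning[OF subset_refl _ nil_set_diff_const _ that])
      show "B \<subseteq> nil_set u" using monomial_nil[OF E(2)] by (auto simp: B_def)
      fix a i m assume "a \<in> nil_set u" "val a i m"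
      from E(3)[OF this] show "\<exists>b\<in>B. val b i m" unfolding B_def by blast
    qed
    then show ?thesis
      by (rule lin_span_subset) (use smult[OF one, of 0] add smult B in auto)
  qed
  moreover have "a \<in> nil_set u" if "a \<in> ?gen" for a
    using that by induction (use S in \<open>auto intro: nil_set_add nil_set_mult\<close>)
  ultimately have "?gen = carrier (nil_algebra u)" by auto
  then show ?thesis unfolding affine_algebra_def using nil_assoc_algebra S by auto
qed

end

section \<open>Generators of the associated graded algebra\<close>

text \<open>The monomial of degree \<open>i\<close>, used to lift a homogeneous element of the
  graded algebra to the Rees ring.\<close>

definition single :: "nat \<Rightarrow> 'a::zero \<Rightarrow> 'a fps" where
  "single i a = Abs_fps (\<lambda>k. if k = i then a else 0)"

lemma single_nth [simp]: "fps_nth (single i a) k = (if k = i then a else 0)"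
  by (simp add: single_def)

lemma single_mult: "single i a * single j b = single (i + j) (a * b :: 'a::ring_1)"
proof (rule fps_ext)
  fix k
  have "fps_nth (single i a * single j b) k =
      (\<Sum>l=0..k. if l = i then a * (if k - l = j then b else 0) else 0)"
    unfolding fps_mult_nth by (intro sum.cong) auto
  also have "\<dots> = fps_nth (single (i + j) (a * b)) k" by (auto simp: sum.delta)
  finally show "fps_nth (single i a * single j b) k = fps_nth (single (i + j) (a * b)) k" .
qed

lemma single_one: "single 0 1 = (1 :: 'a::ring_1 fps)"
  by (rule fps_ext) simp

lemma single_linear:
  "single i (c * a + b) = fps_const c * single i a + single i (b :: 'a::ring_1)"
  by (rule fps_ext) simp

lemma single_rees: "a \<in> adker u (Suc i) \<Longrightarrow> single i a \<in> rees u"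
  by (auto simp: rees_def intro: finite_subset[of _ "{i}"])

context nilpotent_homogeneous
begin

lemma val_adker_le:
  assumes "val a j m" "a \<in> adker u (Suc i)"
  shows "j \<le> i"
proof (rule ccontr)
  assume "\<not> j \<le> i"
  then have "(ad u ^^ j) a = 0"
    using assms(2) adpow_eq_zero_mono[of "Suc i" u a j] by (simp add: adker_def)
  then show False using assms(1) top_degree_nonzero by (auto simp: val_def)
qed

text \<open>The symbols of \<open>u\<close>, \<open>w\<close> and a standard basis generate: symbols
  are multiplicative, and every filtration step is spanned by standard monomials inside it.\<close>

lemma graded_affine: "affine_algebra base_field (graded_algebra u)"
proof -
  have cring: "cring (graded_algebra u)" by (rule graded_cring[OF centralizer_commute])
  obtain E where E: "finite E" "E \<subseteq> nil_set u" "\<And>e. e \<in> E \<Longrightarrow> \<exists>i m. val e i m"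
    "\<And>a i m. a \<in> nil_set u \<Longrightarrow> val a i m \<Longrightarrow> \<exists>e\<in>E. \<exists>p q. val (u ^ p * w ^ q * e) i m"
    using standard_basis[OF subset_refl] by metis
  define B where "B = {u ^ p * w ^ q * e |p q e. e \<in> E}"
  define Gens where "Gens = insert u (insert w E)"
  have "\<exists>i m. val a i m" if "a \<in> Gens" for a
    using that E(3) val_u val_y_power by (auto simp: Gens_def)
  then obtain nd where nd: "\<And>a. a \<in> Gens \<Longrightarrow> \<exists>m. val a (nd a) m" by metis
  define S where "S = (\<lambda>a. graded_class u (single (nd a) a)) ` Gens"
  let ?gen = "algebra_generate base_field (graded_algebra u) S"
  have ker: "a \<in> adker u (Suc i)" if "val a i m" for a i m
    using that by (simp add: val_def adker_def)
  have S: "finite S" using E(1) by (simp add: S_def Gens_def)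
  have "single (nd a) a \<in> rees u" if "a \<in> Gens" for a
    using nd[OF that] ker single_rees by blast
  then have S': "S \<subseteq> carrier (graded_algebra u)" by (auto simp: S_def graded_carrier)
  have "x \<in> carrier (graded_algebra u)" if "x \<in> ?gen" for x
    using that
    by induction (use S' in \<open>auto simp: graded_carrier graded_simps rees_closed\<close>)
  then have sub: "?gen \<subseteq> carrier (graded_algebra u)" by blast
  \<comment> \<open>\<open>P a\<close> says that the symbol of \<open>a\<close>, taken in its own
    nilpotency degree, is generated. Additivity of values makes this stable under products.\<close>
  define P where "P a \<longleftrightarrow> (\<exists>i m. val a i m \<and> graded_class u (single i a) \<in> ?gen)" for a
  have P_gen: "P a" if "a \<in> Gens" for a
  proof -
    have "graded_class u (single (nd a) a) \<in> ?gen"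
      using that by (intro algebra_generate.incl) (simp add: S_def)
    then show ?thesis using nd[OF that] by (auto simp: P_def)
  qed
  have P_mult: "P (a * b)" if "P a" "P b" for a b
  proof -
    obtain i m j k where v: "val a i m" "graded_class u (single i a) \<in> ?gen"
      "val b j k" "graded_class u (single j b) \<in> ?gen"
      using \<open>P a\<close> \<open>P b\<close> unfolding P_def by blast
    have "graded_class u (single (i + j) (a * b)) \<in> ?gen"
      using algebra_generate.mult[OF v(2,4)] v
      by (simp add: graded_mult single_rees ker single_mult)
    then show ?thesis using val_mult[OF v(1,3)] unfolding P_def by blast
  qed
  have "\<one>\<^bsub>graded_algebra u\<^esub> \<in> ?gen" by (rule algebra_generate.one)
  then have one: "graded_class u (single 0 1) \<in> ?gen" by (simp add: graded_one single_one)
  then have P_one: "P 1" unfolding P_def using val_one by blast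
  have P_power: "P (a ^ p)" if "P a" for a p
    by (induction p) (simp_all add: P_one P_mult that)
  have P_B: "P b" if b_in: "b \<in> B" for b
  proof -
    obtain p q e where b: "b = u ^ p * w ^ q * e" and e: "e \<in> E" using b_in by (auto simp: B_def)
    show "P b" unfolding b
      by (intro P_mult P_power[of u] P_power[of w] P_gen) (simp_all add: Gens_def e)
  qed
  \<comment> \<open>Zero is reached as the zero multiple of one.\<close>
  have "0 \<odot>\<^bsub>graded_algebra u\<^esub> graded_class u (single 0 1) \<in> ?gen"
    by (rule algebra_generate.smult[OF _ one]) simp
  then have zero: "graded_class u 0 \<in> ?gen"
    using one_in_adker[of u 0] by (simp add: graded_smult single_rees)
  have homogeneous: "graded_class u (single i a) \<in> ?gen" if a: "a \<in> adker u (Suc i)" for a i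
  proof -
    have nil: "adker u (Suc i) \<subseteq> nil_set u" by (auto simp: nil_set_eq_adker)
    \<comment> \<open>The monomials required have the values of elements of this step, so they
      belong to the step themselves.\<close>
    have "a \<in> lin_span (B \<inter> adker u (Suc i))"
    proof (rule spanning[OF nil _ _ _ a])
      fix a b c assume "a \<in> adker u (Suc i)" "b \<in> adker u (Suc i)"
      then show "a - weyl_const c * b \<in> adker u (Suc i)"
        by (intro adker_diff adker_weyl_const_mult)
    next
      fix a j m assume j: "a \<in> adker u (Suc i)" "val a j m"
      then have "a \<in> nil_set u" using nil by auto
      from E(4)[OF this j(2)] obtain e p q where e: "e \<in> E" "val (u ^ p * w ^ q * e) j m" by blast
      define b where "b = u ^ p * w ^ q * e"
      have b: "b \<in> B" "val b j m" using e by (auto simp: B_def b_def)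
      have "j \<le> i" using j(2,1) by (rule val_adker_le)
      then have "b \<in> adker u (Suc i)" using ker[OF b(2)] adker_mono[of "Suc j" "Suc i" u] by auto
      then show "\<exists>b\<in>B \<inter> adker u (Suc i). val b j m" using b by blast
    qed simp
    then have "a \<in> adker u (Suc i) \<and> graded_class u (single i a) \<in> ?gen"
    proof induction
      case zero
      have "single i 0 = (0 :: 'a weyl fps)" by (rule fps_ext) simp
      then show ?case using \<open>graded_class u 0 \<in> ?gen\<close> by simp
    next
      case (step b a c)
      obtain j m where j: "val b j m" "graded_class u (single j b) \<in> ?gen"
        using P_B step(1) unfolding P_def by blast
      have "graded_class u (single i b) \<in> ?gen"
      proof (cases "j = i")
        case False
        \<comment> \<open>A monomial of smaller nilpotency degree has zero class in degree
          \<open>i\<close>.\<close>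
        have "j \<le> i" using j(1) step(1) val_adker_le by blast
        then have "b \<in> adker u i" using ker[OF j(1)] adker_mono[of "Suc j" i u] False by auto
        then have "graded_class u (single i b) = graded_class u 0"
          by (simp add: graded_class_eq_iff)
        then show ?thesis using zero by simp
      qed (use j in simp)
      then have "c \<odot>\<^bsub>graded_algebra u\<^esub> graded_class u (single i b) \<in> ?gen"
        by (intro algebra_generate.smult) simp_all
      then have "(c \<odot>\<^bsub>graded_algebra u\<^esub> graded_class u (single i b)) \<oplus>\<^bsub>graded_algebra u\<^esub>
          graded_class u (single i a) \<in> ?gen"
        using step by (intro algebra_generate.add) simp_all
      then have "graded_class u (single i (weyl_const c * b + a)) \<in> ?gen"
        using step by (simp add: graded_smult graded_add single_rees single_linear)
      then show ?case using step by (auto intro: adker_add adker_weyl_const_mult)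
    qed
    then show ?thesis by blast
  qed
  have "graded_class u f \<in> ?gen" if f: "f \<in> rees u" for f
  proof -
    \<comment> \<open>Truncations add one homogeneous term at a time and reach \<open>f\<close>
      because its support is finite.\<close>
    define t where "t N = Abs_fps (\<lambda>k. if k < N then fps_nth f k else 0)" for N
    have "graded_class u (t N) \<in> ?gen" for N
    proof (induction N)
      case 0
      have "t 0 = 0" unfolding t_def by (rule fps_ext) simp
      then show ?case using zero by simp
    next
      case (Suc N)
      have "t (Suc N) = t N + single N (fps_nth f N)" unfolding t_def by (rule fps_ext) auto
      moreover have "graded_class u (single N (fps_nth f N)) \<in> ?gen"
        using f by (intro homogeneous) (simp add: rees_def)
      from algebra_generate.add[OF Suc this]
      have "graded_class u (t N + single N (fps_nth f N)) \<in> ?gen" by (simp add: graded_add)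
      ultimately show ?case by simp
    qed
    moreover obtain N where "\<And>k. fps_nth f k \<noteq> 0 \<Longrightarrow> k < N"
      using f by (auto simp: rees_def finite_nat_set_iff_bounded)
    then have "t N = f" unfolding t_def by (intro fps_ext) auto
    ultimately show ?thesis by metis
  qed
  then have "?gen = carrier (graded_algebra u)" using sub by (auto simp: graded_carrier)
  then show ?thesis
    unfolding affine_algebra_def using graded_assoc_algebra[OF cring] S S' by blast
qed

section \<open>Infinite generation of the Weyl algebra as a module\<close>

definition below :: "int \<Rightarrow> 'a weyl set" where
  "below l = {a. \<forall>k>l. comp a k = 0}"

lemma below_add: "a \<in> below l \<Longrightarrow> b \<in> below l \<Longrightarrow> a + b \<in> below l"
  by (simp add: below_def comp_add)

lemma below_sum: "(\<And>i. i \<in> S \<Longrightarrow> f i \<in> below l) \<Longrightarrow> sum f S \<in> below l"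
  by (induction S rule: infinite_finite_induct) (simp_all add: below_add, simp_all add: below_def)

lemma below_mult:
  assumes "a \<in> below l" "b \<in> below m"
  shows "a * b \<in> below (l + m)"
  unfolding below_def
proof (intro CollectI allI impI)
  fix k assume k: "k > l + m"
  show "comp (a * b) k = 0"
    unfolding comp_mult
  proof (rule sum.neutral, rule ballI)
    fix i assume "i \<in> {i. comp a i \<noteq> 0}"
    then have "i \<le> l" using assms(1) by (auto simp: below_def intro: leI)
    then have "k - i > m" using k by simp
    then show "comp a i * comp b (k - i) = 0" using assms(2) by (simp add: below_def)
  qed
qed

lemma below_const: "weyl_const c \<in> below 0"
  using comp_grade[OF const_in_grade] by (simp add: below_def)

lemma below_w_power: "w ^ q \<in> below 0"
proof -
  have "w ^ q \<in> grade (- int (n * q))"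
    using hom_y_power[of "n * q"] by (auto simp: grade_def power_mult)
  from comp_grade[OF this] have "comp (w ^ q) k = (if k = - int (n * q) then w ^ q else 0)" for k .
  moreover have "0 \<le> int (n * q)" by (rule of_nat_0_le_iff)
  ultimately show ?thesis by (fastforce simp: below_def simp del: of_nat_mult)
qed

lemma finite_below:
  assumes "finite S"
  shows "\<exists>l\<ge>0. S \<subseteq> below l"
  using assms
proof induction
  case (insert a S)
  then obtain l where l: "l \<ge> 0" "S \<subseteq> below l" by blast
  obtain m where m: "a \<in> below m"
  proof (cases "a = 0")
    case True
    then show ?thesis using that[of 0] by (simp add: below_def)
  next
    case False
    then show ?thesis using top_degree_exists that by (auto simp: below_def top_degree_def)
  qed
  have "insert a S \<subseteq> below (max l m)" using l m by (auto simp: below_def)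
  then show ?case using l by (intro exI[of _ "max l m"]) auto
qed auto

text \<open>A standard monomial either contains \<open>u\<close> or has degree at most that of a generator.\<close>

lemma nil_set_decomposition:
  "\<exists>l\<ge>0. \<forall>a\<in>nil_set u.
    (\<exists>b r. a = u * b + r \<and> r \<in> below l) \<and> (\<exists>b r. a = b * u + r \<and> r \<in> below l)"
proof -
  obtain E where E: "finite E" "E \<subseteq> nil_set u" "\<And>a i m. a \<in> nil_set u \<Longrightarrow> val a i m \<Longrightarrow>
      \<exists>e\<in>E. \<exists>p q. val (e * w ^ q * u ^ p) i m \<and> val (u ^ p * (e * w ^ q)) i m"
    using standard_basis[OF subset_refl] by metis
  obtain l where l: "l \<ge> 0" "E \<subseteq> below l" using finite_below[OF E(1)] by blast
  \<comment> \<open>Powers of \<open>w\<close> do not raise degrees, so the bound for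
    \<open>E\<close> holds for all \<open>q\<close>.\<close>
  have low: "weyl_const c * (e * w ^ q) \<in> below l" if "e \<in> E" for c e q
    using below_mult[OF below_const below_mult[OF _ below_w_power], of e l c q] l(2) that by auto
  have zero: "0 \<in> below l" by (simp add: below_def)
  have "\<exists>b r. a = u * b + r \<and> r \<in> below l" if "a \<in> nil_set u" for a
  proof -
    have "a \<in> lin_span {u ^ p * (e * w ^ q) |p q e. e \<in> E}"
    proof (rule spanning[OF subset_refl _ nil_set_diff_const _ that])
      show "{u ^ p * (e * w ^ q) |p q e. e \<in> E} \<subseteq> nil_set u" using monomial_nil[OF E(2)] by auto
      fix a i m assume "a \<in> nil_set u" "val a i m"
      from E(3)[OF this] show "\<exists>b\<in>{u ^ p * (e * w ^ q) |p q e. e \<in> E}. val b i m" by blast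
    qed
    then show ?thesis
    proof induction
      case zero
      then show ?case using \<open>0 \<in> below l\<close> by (intro exI[of _ 0]) simp
    next
      case (step d a c)
      then obtain b r p q e where *: "a = u * b + r" "r \<in> below l" "d = u ^ p * (e * w ^ q)" "e \<in> E"
        by blast
      show ?case
      proof (cases p)
        case 0
        then have "weyl_const c * d + a = u * b + (weyl_const c * (e * w ^ q) + r)" using * by simp
        then show ?thesis using below_add[OF low[OF *(4)] *(2)] by blast
      next
        case (Suc p')
        have "weyl_const c * d = u * (weyl_const c * (u ^ p' * (e * w ^ q)))"
          unfolding * Suc by (simp add: mult.assoc) (metis mult.assoc weyl_const_commute)
        then have "weyl_const c * d + a = u * (weyl_const c * (u ^ p' * (e * w ^ q)) + b) + r"
          using * by (simp add: distrib_left add.assoc)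
        then show ?thesis using *(2) by blast
      qed
    qed
  qed
  moreover have "\<exists>b r. a = b * u + r \<and> r \<in> below l" if "a \<in> nil_set u" for a
  proof -
    have "a \<in> lin_span {e * w ^ q * u ^ p |p q e. e \<in> E}"
    proof (rule spanning[OF subset_refl _ nil_set_diff_const _ that])
      show "{e * w ^ q * u ^ p |p q e. e \<in> E} \<subseteq> nil_set u" using monomial_nil[OF E(2)] by auto
      fix a i m assume "a \<in> nil_set u" "val a i m"
      from E(3)[OF this] show "\<exists>b\<in>{e * w ^ q * u ^ p |p q e. e \<in> E}. val b i m" by blast
    qed
    then show ?thesis
    proof induction
      case zero
      then show ?case using \<open>0 \<in> below l\<close> by (intro exI[of _ 0]) simp
    next
      case (step d a c)
      then obtain b r p q e where *: "a = b * u + r" "r \<in> below l" "d = e * w ^ q * u ^ p" "e \<in> E"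
        by blast
      show ?case
      proof (cases p)
        case 0
        then have "weyl_const c * d + a = b * u + (weyl_const c * (e * w ^ q) + r)" using * by simp
        then show ?thesis using below_add[OF low[OF *(4)] *(2)] by blast
      next
        case (Suc p')
        have "weyl_const c * d + a = (weyl_const c * (e * w ^ q * u ^ p') + b) * u + r"
          unfolding * Suc by (simp add: distrib_right mult.assoc power_Suc2 del: power_Suc)
        then show ?thesis using *(2) by blast
      qed
    qed
  qed
  ultimately show ?thesis using l(1) by blast
qed

text \<open>In degree \<open>K\<close> the remainder contributes nothing, and the coefficient of
  \<open>x ^ K\<close> is 1. So 1 would be a multiple of \<alpha> or of a translate of it, which is
  not constant.\<close>

lemma x_power_not_multiple:
  assumes "r \<in> below l" "int K > l"
  shows "x ^ K \<noteq> u * b + r" "x ^ K \<noteq> b * u + r"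
proof -
  have "x ^ K \<in> grade (int K)" using hom_x_power by (auto simp: grade_def)
  from comp_grade[OF this] have K: "comp (x ^ K) (int K) = x ^ K" by simp
  have r: "comp r (int K) = 0" using assms by (simp add: below_def)
  obtain q where q: "hom (int K - int n) q (comp b (int K - int n))"
    using comp_in_grade[of b "int K - int n"] by (auto simp: grade_def)
  have nontrivial: "\<alpha> * p \<noteq> 1" "p * translate m \<alpha> \<noteq> 1" for p m
  proof -
    have "\<not> \<beta> dvd 1" if "degree \<beta> > 0" for \<beta> :: "'a poly"
      using that is_unit_iff_degree[of \<beta>] by fastforce
    moreover have "degree (translate m \<alpha>) > 0" using degree_pos by (simp add: degree_pcompose)
    ultimately show "\<alpha> * p \<noteq> 1" "p * translate m \<alpha> \<noteq> 1"
      using degree_pos dvd_triv_left dvd_triv_right by metis+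
  qed
  show "x ^ K \<noteq> u * b + r"
  proof
    assume "x ^ K = u * b + r"
    then have "x ^ K = u * comp b (int K - int n)"
      using K r by (metis add.right_neutral comp_add comp_grade_mult(1)[OF u_grade])
    then have "hom (int K) (\<alpha> * translate (int n) q) (x ^ K)" using hom_mult[OF hom_u q] by simp
    then show False using hom_x_power hom_unique nontrivial by metis
  qed
  show "x ^ K \<noteq> b * u + r"
  proof
    assume "x ^ K = b * u + r"
    then have "x ^ K = comp b (int K - int n) * u"
      using K r by (metis add.right_neutral comp_add comp_grade_mult(2)[OF u_grade])
    then have "hom (int K) (q * translate (int K - int n) \<alpha>) (x ^ K)" using hom_mult[OF q hom_u] by simp
    then show False using hom_x_power hom_unique nontrivial by metis
  qed
qed

text \<open>Dividing the coefficients \<open>c s\<close> by \<open>u\<close> on the left writes each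
  element as a left multiple of \<open>u\<close> plus a remainder of uniformly bounded degree, which
  fails for large powers of \<open>x\<close>.\<close>

lemma not_fg_left: "\<not> fg_left_over (nil_set u)"
proof
  assume "fg_left_over (nil_set u)"
  then obtain S where S: "finite S" "\<And>a. \<exists>c. (\<forall>s\<in>S. c s \<in> nil_set u) \<and> a = (\<Sum>s\<in>S. c s * s)"
    unfolding fg_left_over_def by blast
  obtain l where l: "l \<ge> 0" "\<forall>a\<in>nil_set u.
      (\<exists>b r. a = u * b + r \<and> r \<in> below l) \<and> (\<exists>b r. a = b * u + r \<and> r \<in> below l)"
    using nil_set_decomposition by blast
  obtain k where k: "k \<ge> 0" "S \<subseteq> below k" using finite_below[OF S(1)] by blast
  \<comment> \<open>One more than the bound \<open>l + k\<close> for the sum of the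
    remainders.\<close>
  define K where "K = nat (l + k + 1)"
  obtain c where c: "\<And>s. s \<in> S \<Longrightarrow> c s \<in> nil_set u" "x ^ K = (\<Sum>s\<in>S. c s * s)"
    using S(2) by blast
  have "\<forall>s. \<exists>b r. s \<in> S \<longrightarrow> c s = u * b + r \<and> r \<in> below l" using c(1) l(2) by blast
  then obtain b r where br: "\<And>s. s \<in> S \<Longrightarrow> c s = u * b s + r s \<and> r s \<in> below l" by metis
  have "(\<Sum>s\<in>S. c s * s) = (\<Sum>s\<in>S. u * (b s * s) + r s * s)"
    using br by (intro sum.cong) (auto simp: distrib_right mult.assoc)
  then have "x ^ K = u * (\<Sum>s\<in>S. b s * s) + (\<Sum>s\<in>S. r s * s)"
    unfolding c(2) by (simp add: sum.distrib sum_distrib_left)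
  moreover have "(\<Sum>s\<in>S. r s * s) \<in> below (l + k)"
    using br k(2) by (intro below_sum below_mult) auto
  ultimately show False using x_power_not_multiple(1) k l by (simp add: K_def)
qed

text \<open>Coefficients now stand on the right, so \<open>u\<close> is split off on the right and
  can be pulled out of the sum on that side.\<close>

lemma not_fg_right: "\<not> fg_right_over (nil_set u)"
proof
  assume "fg_right_over (nil_set u)"
  then obtain S where S: "finite S" "\<And>a. \<exists>c. (\<forall>s\<in>S. c s \<in> nil_set u) \<and> a = (\<Sum>s\<in>S. s * c s)"
    unfolding fg_right_over_def by blast
  obtain l where l: "l \<ge> 0" "\<forall>a\<in>nil_set u.
      (\<exists>b r. a = u * b + r \<and> r \<in> below l) \<and> (\<exists>b r. a = b * u + r \<and> r \<in> below l)"
    using nil_set_decomposition by blast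
  obtain k where k: "k \<ge> 0" "S \<subseteq> below k" using finite_below[OF S(1)] by blast
  define K where "K = nat (k + l + 1)"
  obtain c where c: "\<And>s. s \<in> S \<Longrightarrow> c s \<in> nil_set u" "x ^ K = (\<Sum>s\<in>S. s * c s)"
    using S(2) by blast
  have "\<forall>s. \<exists>b r. s \<in> S \<longrightarrow> c s = b * u + r \<and> r \<in> below l" using c(1) l(2) by blast
  then obtain b r where br: "\<And>s. s \<in> S \<Longrightarrow> c s = b s * u + r s \<and> r s \<in> below l" by metis
  have "(\<Sum>s\<in>S. s * c s) = (\<Sum>s\<in>S. (s * b s) * u + s * r s)"
    using br by (intro sum.cong) (auto simp: distrib_left mult.assoc)
  then have "x ^ K = (\<Sum>s\<in>S. s * b s) * u + (\<Sum>s\<in>S. s * r s)"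
    unfolding c(2) by (simp add: sum.distrib sum_distrib_right)
  moreover have "(\<Sum>s\<in>S. s * r s) \<in> below (k + l)"
    using br k(2) by (intro below_sum below_mult) auto
  ultimately show False using x_power_not_multiple(2) k l by (simp add: K_def)
qed

lemma finiteness_properties:
  "(cring (graded_algebra u) \<and> affine_algebra base_field (graded_algebra u) \<and>
    affine_algebra base_field (nil_algebra u) \<and> noetherian (nil_algebra u)) \<and>
   (\<not> fg_left_over (nil_set u) \<and> \<not> fg_right_over (nil_set u))"
  using graded_cring[OF centralizer_commute] graded_affine nil_affine nil_noetherian
    not_fg_left not_fg_right by blast

end

section \<open>Homogeneous elements of weakly nilpotent type\<close>

context weyl_rep
begin

text \<open>A constant coefficient would make every element locally nilpotent; otherwise degree zero
  would reduce the locally nilpotent elements to the centralizer. Weak nilpotency excludes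
  both.\<close>

lemma weakly_nilpotent_hom:
  assumes "hom (int n) \<alpha> u" "weakly_nilpotent_type u"
  shows "nilpotent_homogeneous \<rho> x y u n \<alpha>"
proof
  have wn: "u \<notin> range weyl_const" "nil_filt u 0 \<noteq> nil_set u" "nil_set u \<noteq> UNIV"
    using assms(2) by (auto simp: weakly_nilpotent_type_def weyl_centralizer_def)
  show "hom (int n) \<alpha> u" by fact
  have c: "n \<noteq> 0 \<and> degree \<alpha> \<noteq> 0"
  proof (cases "degree \<alpha> = 0")
    case True
    then obtain c where "\<alpha> = [:c:]" by (rule degree_eq_zeroE)
    then have u: "hom (int n) [:c:] u" using assms(1) by simp
    then have "nil_set u = UNIV" by (rule nil_set_constant_coefficient)
    then show ?thesis using wn by simp
  next
    case False
    then have "n \<noteq> 0" using nil_set_degree_zero[of \<alpha> u] assms(1) wn(2) by (intro notI) auto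
    then show ?thesis using False by simp
  qed
  then show "n > 0" "degree \<alpha> > 0" by simp_all
qed

text \<open>Elements of degree zero form a subalgebra; with \<open>b = weyl_H\<close> this turns the
  components of the grading into instances of \<open>hom\<close>.\<close>

lemma algebra_generate_hom:
  assumes "a \<in> algebra_generate base_field weyl_algebra {b}" "hom 0 p b"
  shows "\<exists>q. hom 0 q a"
  using assms(1)
proof induction
  case one
  then show ?case using hom_one by (auto simp: weyl_algebra_def)
next
  case (incl c)
  then show ?case using assms(2) by auto
next
  case (add c d)
  then obtain q r where "hom 0 q c" "hom 0 r d" by blast
  from hom_add[OF this] show ?case by (auto simp: weyl_algebra_def)
next
  case (mult c d)
  then obtain q r where "hom 0 q c" "hom 0 r d" by blast
  from hom_mult[OF this] show ?case by (auto simp: weyl_algebra_def)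
next
  case (smult k c)
  then obtain q where "hom 0 q c" by blast
  from hom_const_mult[OF this] show ?case by (auto simp: weyl_algebra_def)
qed

end

theorem corollary5p3:
  fixes u :: "'k::field_char_0 weyl"
  assumes "weyl_homogeneous u"
    and "weakly_nilpotent_type u"
  shows "(cring (graded_algebra u) \<and> affine_algebra base_field (graded_algebra u) \<and>
          affine_algebra base_field (nil_algebra u) \<and> noetherian (nil_algebra u)) \<and>
         (\<not> fg_left_over (nil_set u) \<and> \<not> fg_right_over (nil_set u))"
proof -
  obtain i a where u: "u = a * weyl_v i" "a \<in> algebra_generate base_field weyl_algebra {weyl_H}"
    using assms(1) unfolding weyl_homogeneous_def weyl_component_def by blast
  show ?thesis
  proof (cases "i \<ge> 0")
    case True
    interpret weyl_rep "weyl_diff True" weyl_X "weyl_Y :: 'k weyl" by (rule weyl_rep_True)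
    have "hom 0 [:0, 1:] weyl_H" using hom_h by (simp add: weyl_H_def h_def)
    then obtain q where "hom 0 q a" using algebra_generate_hom[OF u(2)] by blast
    from hom_mult[OF this hom_x_power[of "nat i"]] have "hom (int (nat i)) q u"
      using True u(1) by (simp add: weyl_v_def)
    then interpret nilpotent_homogeneous "weyl_diff True" weyl_X weyl_Y u "nat i" q
      using assms(2) by (rule weakly_nilpotent_hom)
    show ?thesis by (rule finiteness_properties)
  next
    case False
    \<comment> \<open>Here \<open>weyl_Y\<close> raises the degree, so \<open>u\<close> acquires the
      positive degree \<open>- i\<close>.\<close>
    interpret weyl_rep "weyl_diff False" weyl_Y "- weyl_X :: 'k weyl" by (rule weyl_rep_False)
    \<comment> \<open>In this action \<open>weyl_H\<close> is minus the product of the shift with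
      the other generator, hence still of degree zero.\<close>
    have "weyl_H = weyl_Y * (weyl_const (- 1) * - weyl_X :: 'k weyl)"
      by (simp add: weyl_H_def weyl_const_minus)
    then obtain p where "hom 0 p weyl_H"
      using hom_mult[OF hom_x hom_const_mult[OF hom_y, of "- 1"]] by auto
    then obtain q where "hom 0 q a" using algebra_generate_hom[OF u(2)] by blast
    from hom_mult[OF this hom_x_power[of "nat (- i)"]] have "hom (int (nat (- i))) q u"
      using False u(1) by (simp add: weyl_v_def)
    then interpret nilpotent_homogeneous "weyl_diff False" weyl_Y "- weyl_X" u "nat (- i)" q
      using assms(2) by (rule weakly_nilpotent_hom)
    show ?thesis by (rule finiteness_properties)
  qed
qed

end
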